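(* Let $t \geq 2$ be fixed, let $T=\{1,\ldots,t\}$, and let $\mathcal{F}$ be a family of subsets of $T$. For every sufficiently large $n$ one can construct graphs $G_i$, $i\in T$, each on $n$ vertices, such that for every $X \subseteq T$ the following two statements hold: \begin{enumerate} \item If $X$ contains some $F\in\mathcal{F}$, then $c\left(\sum_{i\in X}G_i\right) \geq n^{1/|F|} \geq n^{1/t}$. \item If $X$ does not contain any $F\in\mathcal{F}$, then $$c\left(\sum_{i\in X}G_i\right) \leq \mathrm{e}^{(1+o(1))\sqrt{2\log n \log \log n}},$$ where the $o(1)$-term tends to $0$ as $n\to\infty$. \end{enumerate}
   Context: For graphs $G_1=(V_1,E_1)$, $G_2=(V_2,E_2)$, the strong product $G_1\cdot G_2$ has vertex set $V_1\times V_2$, with distinct $(u_1,u_2)\neq(v_1,v_2)$ adjacent iff for each $i=1,2$ either $u_i=v_i$ or $u_iv_i\in E_i$. $G^k$ denotes the $k$-th strong power of $G$: vertex set $V(G)^k$, distinct $k$-tuples adjacent iff in each coordinate the entries are equal or adjacent in $G$. $\alpha(G)$ is the independence number, and the Shannon capacity is $c(G)=\lim_{k\to\infty}\alpha(G^k)^{1/k}=\sup_k \alpha(G^k)^{1/k}$. For graphs $G_i$, $\sum_{i\in X} G_i$ denotes their disjoint union. $\log$ denotes the natural logarithm. *)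

theory Defs
  imports Complex_Main "Graph_Theory.Pair_Digraph"
begin

text \<open>
  A finite simple graph is a \<open>pair_graph\<close>: an undirected edge \<open>uv\<close> is the pair of arcs
  \<open>(u, v)\<close> and \<open>(v, u)\<close>.
\<close>

definition independent_set :: "'a pair_pre_digraph \<Rightarrow> 'a set \<Rightarrow> bool" where
  "independent_set G S \<longleftrightarrow> S \<subseteq> pverts G \<and> (\<forall>u\<in>S. \<forall>v\<in>S. (u, v) \<notin> parcs G)"

definition independence_number :: "'a pair_pre_digraph \<Rightarrow> nat" where
  "independence_number G = Max {card S | S. independent_set G S}"

text \<open>The \<open>k\<close>-tuples over \<open>V(G)\<close> are the lists of length \<open>k\<close> with entries in \<open>V(G)\<close>.\<close>

definition strong_power :: "'a pair_pre_digraph \<Rightarrow> nat \<Rightarrow> 'a list pair_pre_digraph" where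
  "strong_power G k = (let V = {xs. length xs = k \<and> set xs \<subseteq> pverts G} in
     \<lparr> pverts = V,
       parcs = {(xs, ys). xs \<in> V \<and> ys \<in> V \<and> xs \<noteq> ys \<and>
                  (\<forall>j<k. xs ! j = ys ! j \<or> (xs ! j, ys ! j) \<in> parcs G)} \<rparr>)"

definition shannon_capacity :: "'a pair_pre_digraph \<Rightarrow> real" where
  "shannon_capacity G =
     lim (\<lambda>k. real (independence_number (strong_power G k)) powr (1 / real k))"

definition disjoint_graph_union ::
    "'i set \<Rightarrow> ('i \<Rightarrow> 'a pair_pre_digraph) \<Rightarrow> ('i \<times> 'a) pair_pre_digraph" where
  "disjoint_graph_union X G =
     \<lparr> pverts = (SIGMA i:X. pverts (G i)),
       parcs = {((i, u), (i, v)) | i u v. i \<in> X \<and> (u, v) \<in> parcs (G i)} \<rparr>"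

lemma pair_graph_iff:
  "pair_graph G \<longleftrightarrow> finite (pverts G) \<and> parcs G \<subseteq> pverts G \<times> pverts G \<and>
     sym (parcs G) \<and> irrefl (parcs G)"
proof
  assume "pair_graph G"
  then interpret pair_graph G .
  show "finite (pverts G) \<and> parcs G \<subseteq> pverts G \<times> pverts G \<and> sym (parcs G) \<and> irrefl (parcs G)"
    using pair_finite_verts in_arcsD1 in_arcsD2 pair_sym_arcs pair_no_loops
    by (fastforce simp: irrefl_def symmetric_def)
next
  assume *: "finite (pverts G) \<and> parcs G \<subseteq> pverts G \<times> pverts G \<and> sym (parcs G) \<and> irrefl (parcs G)"
  then have "finite (parcs G)"
    by (meson finite_SigmaI finite_subset)
  with * show "pair_graph G"
    by unfold_locales (auto simp: irrefl_def symmetric_def)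
qed

lemma finite_strong_power_verts:
  assumes "finite (pverts G)"
  shows "finite (pverts (strong_power G k))"
  using finite_lists_length_eq[OF assms, of k]
  by (simp add: strong_power_def conj_commute)

lemma pair_graph_strong_power:
  assumes "pair_graph G"
  shows "pair_graph (strong_power G k)"
proof -
  have "sym (parcs G)" and fin: "finite (pverts G)"
    using assms by (auto simp: pair_graph_iff)
  then have "sym (parcs (strong_power G k))"
    unfolding strong_power_def sym_def Let_def by (auto; metis)
  with finite_strong_power_verts[OF fin] show ?thesis
    by (auto simp: pair_graph_iff strong_power_def Let_def irrefl_def)
qed

lemma pair_graph_disjoint_graph_union:
  assumes "finite X" "\<And>i. i \<in> X \<Longrightarrow> pair_graph (G i)"
  shows "pair_graph (disjoint_graph_union X G)"
  using assms unfolding pair_graph_iff disjoint_graph_union_def sym_def irrefl_def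
  by (auto; blast)

lemma finite_independent_sets:
  assumes "finite (pverts G)"
  shows "finite {S. independent_set G S}"
  by (rule finite_subset[OF _ finite_Pow_iff[THEN iffD2, OF assms]])
    (auto simp: independent_set_def)

lemma card_le_independence_number:
  assumes "finite (pverts G)" "independent_set G S"
  shows "card S \<le> independence_number G"
proof -
  have "finite {card S | S. independent_set G S}"
    using finite_imageI[OF finite_independent_sets[OF assms(1)], of card]
    by (simp add: setcompr_eq_image)
  with assms(2) show ?thesis
    unfolding independence_number_def by (intro Max_ge) auto
qed

lemma ex_max_independent_set:
  assumes "finite (pverts G)"
  obtains S where "independent_set G S" "card S = independence_number G"
proof -
  have "finite {card S | S. independent_set G S}"
    using finite_imageI[OF finite_independent_sets[OF assms], of card]
    by (simp add: setcompr_eq_image)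
  moreover have "independent_set G {}"
    by (simp add: independent_set_def)
  ultimately have "independence_number G \<in> {card S | S. independent_set G S}"
    unfolding independence_number_def by (intro Max_in) auto
  then show ?thesis using that by auto
qed

lemma independence_number_le_card:
  assumes "finite (pverts G)"
  shows "independence_number G \<le> card (pverts G)"
  using ex_max_independent_set[OF assms] assms
  by (metis card_mono independent_set_def)

lemma independence_number_strong_power_le:
  assumes "finite (pverts G)"
  shows "independence_number (strong_power G k) \<le> card (pverts G) ^ k"
proof -
  have "card (pverts (strong_power G k)) = card (pverts G) ^ k"
    using card_lists_length_eq[OF assms, of k]
    by (simp add: strong_power_def conj_commute)
  then show ?thesis
    using independence_number_le_card[OF finite_strong_power_verts[OF assms]] by metis
qed

lemma independence_number_strong_power_add:
  assumes fin: "finite (pverts G)"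
  shows "independence_number (strong_power G k) * independence_number (strong_power G l)
           \<le> independence_number (strong_power G (k + l))"
proof -
  obtain S where S: "independent_set (strong_power G k) S"
    "card S = independence_number (strong_power G k)"
    using ex_max_independent_set[OF finite_strong_power_verts[OF fin]] by metis
  obtain R where R: "independent_set (strong_power G l) R"
    "card R = independence_number (strong_power G l)"
    using ex_max_independent_set[OF finite_strong_power_verts[OF fin]] by metis
  define A where "A = (\<lambda>(xs, ys). xs @ ys) ` (S \<times> R)"
  have lenS: "length xs = k" "set xs \<subseteq> pverts G" if "xs \<in> S" for xs
    using S(1) that by (auto simp: independent_set_def strong_power_def Let_def)
  have lenR: "length xs = l" "set xs \<subseteq> pverts G" if "xs \<in> R" for xs
    using R(1) that by (auto simp: independent_set_def strong_power_def Let_def)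
  have indS: "\<exists>j<k. xs ! j \<noteq> ys ! j \<and> (xs ! j, ys ! j) \<notin> parcs G"
    if "xs \<in> S" "ys \<in> S" "xs \<noteq> ys" for xs ys
    using S(1) that lenS[OF that(1)] lenS[OF that(2)]
    by (auto simp: independent_set_def strong_power_def Let_def)
  have indR: "\<exists>j<l. xs ! j \<noteq> ys ! j \<and> (xs ! j, ys ! j) \<notin> parcs G"
    if "xs \<in> R" "ys \<in> R" "xs \<noteq> ys" for xs ys
    using R(1) that lenR[OF that(1)] lenR[OF that(2)]
    by (auto simp: independent_set_def strong_power_def Let_def)
  have "inj_on (\<lambda>(xs, ys). xs @ ys) (S \<times> R)"
    by (auto simp: inj_on_def lenS)
  then have card: "card A = card S * card R"
    by (simp add: A_def card_image card_cartesian_product)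
  have noarc: "\<exists>j<k+l. zs ! j \<noteq> ws ! j \<and> (zs ! j, ws ! j) \<notin> parcs G"
    if zw: "zs \<in> A" "ws \<in> A" "zs \<noteq> ws" for zs ws
  proof -
    from zw obtain x y x' y' where *: "zs = x @ y" "ws = x' @ y'" "x \<in> S" "x' \<in> S" "y \<in> R" "y' \<in> R"
      by (auto simp: A_def)
    show ?thesis
    proof (cases "x = x'")
      case False
      then obtain j where "j < k" "x ! j \<noteq> x' ! j \<and> (x ! j, x' ! j) \<notin> parcs G"
        using indS * by blast
      then show ?thesis
        using * by (intro exI[of _ j]) (auto simp: nth_append lenS)
    next
      case True
      then have "y \<noteq> y'" using * zw by auto
      then obtain j where "j < l" "y ! j \<noteq> y' ! j \<and> (y ! j, y' ! j) \<notin> parcs G"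
        using indR * by blast
      then show ?thesis
        using * by (intro exI[of _ "k + j"]) (auto simp: nth_append lenS)
    qed
  qed
  have sub: "A \<subseteq> pverts (strong_power G (k + l))"
    using lenS lenR by (fastforce simp: A_def strong_power_def Let_def)
  have "independent_set (strong_power G (k + l)) A"
    unfolding independent_set_def
  proof (intro conjI sub ballI)
    fix zs ws assume "zs \<in> A" "ws \<in> A"
    then show "(zs, ws) \<notin> parcs (strong_power G (k + l))"
      using noarc[of zs ws] by (auto simp: strong_power_def Let_def)
  qed
  from card_le_independence_number[OF finite_strong_power_verts[OF fin] this]
  show ?thesis using card S R by simp
qed

lemma independence_number_strong_power_pos:
  assumes "finite (pverts G)" "pverts G \<noteq> {}"
  shows "independence_number (strong_power G k) \<ge> 1"
proof -
  from assms obtain v where "v \<in> pverts G" by blast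
  then have "independent_set (strong_power G k) {replicate k v}"
    by (auto simp: independent_set_def strong_power_def Let_def)
  from card_le_independence_number[OF finite_strong_power_verts[OF assms(1)] this]
  show ?thesis by simp
qed

lemma independence_number_strong_power_mult:
  assumes "finite (pverts G)" "pverts G \<noteq> {}"
  shows "independence_number (strong_power G m) ^ q
           \<le> independence_number (strong_power G (m * q))"
proof (induction q)
  case 0
  then show ?case using independence_number_strong_power_pos[OF assms] by simp
next
  case (Suc q)
  then have "independence_number (strong_power G m) ^ Suc q
      \<le> independence_number (strong_power G m) * independence_number (strong_power G (m * q))"
    by simp
  also have "\<dots> \<le> independence_number (strong_power G (m + m * q))"
    by (rule independence_number_strong_power_add[OF assms(1)])
  finally show ?case by simp
qed

lemma tendsto_div_over:
  assumes "m \<ge> 1"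
  shows "(\<lambda>k. real (k div m) / real k) \<longlonglongrightarrow> 1 / real m"
proof (rule tendsto_sandwich)
  have low: "1 / real m - 1 / real k \<le> real (k div m) / real k" if "k \<ge> 1" for k
  proof -
    have "k < m * (k div m) + m"
      using assms mod_less_divisor[of m k] mult_div_mod_eq[of m k] by linarith
    then have "real k \<le> real m * real (k div m) + real m"
      by (metis less_imp_le of_nat_add of_nat_le_iff of_nat_mult)
    then have "real k - real m \<le> real m * real (k div m)" by simp
    then have "(real k - real m) / (real m * real k) \<le> real m * real (k div m) / (real m * real k)"
      by (intro divide_right_mono) auto
    then show ?thesis using assms that by (simp add: diff_divide_distrib)
  qed
  show "\<forall>\<^sub>F k in sequentially. 1 / real m - 1 / real k \<le> real (k div m) / real k"
    using low by (auto simp: eventually_sequentially)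
  have up: "real (k div m) / real k \<le> 1 / real m" if "k \<ge> 1" for k
  proof -
    have "real m * real (k div m) \<le> real k"
      by (metis of_nat_le_iff of_nat_mult times_div_less_eq_dividend)
    then show ?thesis using assms that by (simp add: field_simps)
  qed
  show "\<forall>\<^sub>F k in sequentially. real (k div m) / real k \<le> 1 / real m"
    using up by (auto simp: eventually_sequentially)
  have "(\<lambda>k. 1 / real m - 1 / real k) \<longlonglongrightarrow> 1 / real m - 0"
    by (intro tendsto_intros lim_1_over_n)
  then show "(\<lambda>k. 1 / real m - 1 / real k) \<longlonglongrightarrow> 1 / real m" by simp
qed simp

text \<open>
  The limit defining the Shannon capacity exists and equals the supremum (Fekete's lemma).
\<close>

theorem
  assumes fin: "finite (pverts G)"
  shows shannon_capacity_LIMSEQ: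
      "(\<lambda>k. real (independence_number (strong_power G k)) powr (1 / real k))
         \<longlonglongrightarrow> shannon_capacity G" (is ?A)
    and shannon_capacity_bdd_above:
      "bdd_above ((\<lambda>k. real (independence_number (strong_power G k)) powr (1 / real k)) ` {1..})"
        (is ?B)
    and shannon_capacity_eq_SUP:
      "shannon_capacity G =
         (SUP k\<in>{1..}. real (independence_number (strong_power G k)) powr (1 / real k))" (is ?C)
proof -
  define a where "a = (\<lambda>k. real (independence_number (strong_power G k)))"
  define b where "b = (\<lambda>k. a k powr (1 / real k))"
  define L where "L = (SUP k\<in>{1..}. b k)"
  have a0: "a k \<ge> 0" for k by (simp add: a_def)
  have bub: "b k \<le> real (card (pverts G))" if "k \<ge> 1" for k
  proof -
    have "a k \<le> real (card (pverts G)) ^ k"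
      unfolding a_def using independence_number_strong_power_le[OF fin, of k]
      by (metis of_nat_le_iff of_nat_power)
    then have "b k \<le> (real (card (pverts G)) ^ k) powr (1 / real k)"
      unfolding b_def using a0 by (intro powr_mono2) auto
    also have "\<dots> = real (card (pverts G))"
      using that by (cases "card (pverts G) = 0")
        (auto simp: powr_realpow[symmetric] powr_powr)
    finally show ?thesis .
  qed
  then have bdd: "bdd_above (b ` {1..})" by (intro bdd_aboveI) auto
  then have bL: "b k \<le> L" if "k \<ge> 1" for k
    unfolding L_def using that by (intro cSUP_upper) auto
  have "b \<longlonglongrightarrow> L"
  proof (cases "pverts G = {}")
    case True
    then have b0: "b k = 0" if "k \<ge> 1" for k
      using bub[OF that] by (simp add: b_def antisym)
    then have "L = 0" unfolding L_def by (subst SUP_cong[OF refl, of _ b "\<lambda>_. 0"]) auto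
    moreover have "b \<longlonglongrightarrow> 0"
      by (rule tendsto_eventually) (use b0 in \<open>auto simp: eventually_sequentially\<close>)
    ultimately show ?thesis by simp
  next
    case ne: False
    have a1: "a k \<ge> 1" for k
      using independence_number_strong_power_pos[OF fin ne, of k] by (simp add: a_def)
    show ?thesis
    proof (rule order_tendstoI)
      fix y assume "y < L"
      then obtain m where m: "m \<ge> 1" "y < b m"
        unfolding L_def using less_cSUP_iff[OF _ bdd] by auto
      have low: "a m powr (real (k div m) / real k) \<le> b k" if "k \<ge> 1" for k
      proof -
        have "a m ^ (k div m) \<le> a (m * (k div m))"
          unfolding a_def using independence_number_strong_power_mult[OF fin ne, of m "k div m"]
          by (metis of_nat_le_iff of_nat_power)
        also have "\<dots> \<le> a (m * (k div m)) * a (k mod m)"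
          using a1[of "k mod m"] a0[of "m * (k div m)"] by (simp add: mult_le_cancel_left1)
        also have "\<dots> \<le> a (m * (k div m) + k mod m)"
          unfolding a_def
          using independence_number_strong_power_add[OF fin, of "m * (k div m)" "k mod m"]
          by (metis of_nat_le_iff of_nat_mult)
        finally have "a m ^ (k div m) \<le> a k" by simp
        then have "(a m ^ (k div m)) powr (1 / real k) \<le> b k"
          unfolding b_def using a0 by (intro powr_mono2) auto
        moreover have "a m > 0" using a1[of m] by simp
        ultimately show ?thesis
          by (simp add: powr_realpow[symmetric] powr_powr)
      qed
      have "(\<lambda>k. a m powr (real (k div m) / real k)) \<longlonglongrightarrow> b m"
        unfolding b_def using a1[of m] by (intro tendsto_powr tendsto_const tendsto_div_over m) auto
      then have "\<forall>\<^sub>F k in sequentially. y < a m powr (real (k div m) / real k)"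
        using m order_tendstoD(1) by blast
      then show "\<forall>\<^sub>F k in sequentially. y < b k"
        using eventually_ge_at_top[of 1] by eventually_elim (use low in force)
    next
      fix y assume "L < y"
      then show "\<forall>\<^sub>F k in sequentially. b k < y"
        by (intro eventually_mono[OF eventually_ge_at_top[of 1]]) (use bL in force)
    qed
  qed
  moreover have "shannon_capacity G = lim b"
    by (simp add: shannon_capacity_def b_def a_def)
  ultimately have "shannon_capacity G = L" using limI by metis
  then show ?A ?B ?C
    using \<open>b \<longlonglongrightarrow> L\<close> bdd by (simp_all add: L_def b_def a_def)
qed

end

theory Submission
  imports Defs "HOL-Complex_Analysis.Complex_Analysis" "HOL-Number_Theory.Prime_Powers"
    "HOL-Real_Asymp.Real_Asymp"
begin

text \<open>
  Call \<open>Y \<subseteq> T\<close> unqualified if it contains no member of \<open>\<F>\<close>. Choose \<open>x\<close> with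
  \<open>n \<approx> x powr (x\<^sup>2)\<close> and attach to each \<open>Y\<close> its own prime power \<open>q\<^sub>Y\<close> in \<open>[x, (1 + \<eta>) x]\<close>. The vertices
  are \<open>x\<^sup>2\<close>-subsets \<open>A\<close> of an \<open>x\<^sup>3\<close>-set. Since \<open>0 < |A - B| \<le> x\<^sup>2 < q\<^sub>Y q\<^sub>Z\<close>, at most one \<open>q\<^sub>Y\<close> divides
  \<open>|A - B|\<close>; this colours some of the pairs \<open>AB\<close>, and \<open>AB\<close> is an edge of \<open>G\<^sub>i\<close> iff its colour is an
  unqualified \<open>Y\<close> with \<open>i \<in> Y\<close>. If \<open>F \<in> \<F>\<close>, then no pair is an edge of all \<open>G\<^sub>i\<close>, \<open>i \<in> F\<close>, so the
  diagonal is independent in \<open>\<Prod>i\<in>F. G\<^sub>i\<close>. If \<open>X\<close> is unqualified, then \<open>q\<^sub>X\<close> does not divide \<open>|A - B|\<close>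
  for non-edges \<open>AB\<close> of \<open>G\<^sub>i\<close>, \<open>i \<in> X\<close>, and the Frankl-Wilson matrix of rank at most
  \<open>(x\<^sup>3 + q\<^sub>X) choose (q\<^sub>X - 1)\<close> over the prime field bounds the capacity in the manner of Haemers.

  The constant in the exponent requires prime powers in \<open>[x, (1 + \<eta>) x]\<close> for every large \<open>x\<close>, for each
  \<open>\<eta> > 0\<close>. By the non-vanishing of \<open>\<zeta>\<close> on \<open>Re s = 1\<close>, the series \<open>\<Sum>n. (\<Lambda>(n) - 1) n powr (- s)\<close> extends
  continuously to \<open>Re s \<ge> 1\<close>. Integrating it against a Fejer kernel and applying the Riemann-Lebesgue
  lemma shows that, near a large \<open>x\<close>, the weights \<open>\<Lambda>(n) / n\<close> and \<open>1 / n\<close> have almost the same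
  Fejer means.
\<close>

section \<open>Capacity bounds from orthogonal representations\<close>

text \<open>The vectors \<open>w u\<close> are linearly independent modulo \<open>p\<close>. In
  place of a dimension argument the proof counts: the \<open>p ^ card S\<close> coefficient vectors
  yield distinct combinations among the \<open>p ^ card I\<close> vectors modulo
  \<open>p\<close>.\<close>

lemma card_le_of_orthogonal_mod_prime:
  fixes w :: "'v \<Rightarrow> 'i \<Rightarrow> int" and p :: int
  assumes fin: "finite S" "finite I" and p: "prime p"
    and diag: "\<And>u. u \<in> S \<Longrightarrow> \<not> p dvd (\<Sum>i\<in>I. w u i * w u i)"
    and off: "\<And>u v. u \<in> S \<Longrightarrow> v \<in> S \<Longrightarrow> u \<noteq> v \<Longrightarrow> p dvd (\<Sum>i\<in>I. w u i * w v i)"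
  shows "card S \<le> card I"
proof -
  define \<Phi> where "\<Phi> c = (\<lambda>i\<in>I. (\<Sum>u\<in>S. c u * w u i) mod p)" for c :: "'v \<Rightarrow> int"
  have p1: "p > 1" using p by (simp add: prime_gt_1_int)
  have "inj_on \<Phi> (S \<rightarrow>\<^sub>E {0..<p})"
  proof (rule inj_onI)
    fix c d assume c: "c \<in> S \<rightarrow>\<^sub>E {0..<p}" and d: "d \<in> S \<rightarrow>\<^sub>E {0..<p}" and eq: "\<Phi> c = \<Phi> d"
    have dvd: "p dvd (\<Sum>u\<in>S. (c u - d u) * w u i)" if "i \<in> I" for i
    proof -
      have "(\<Sum>u\<in>S. c u * w u i) mod p = (\<Sum>u\<in>S. d u * w u i) mod p"
        using fun_cong[OF eq, of i] that by (simp add: \<Phi>_def)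
      then show ?thesis by (simp add: mod_eq_dvd_iff left_diff_distrib sum_subtractf)
    qed
    show "c = d"
    proof (rule PiE_ext[OF c d])
      fix v assume v: "v \<in> S"
      \<comment> \<open>Modulo \<open>p\<close>, pairing the combination with \<open>w v\<close>
        removes every term except that of \<open>v\<close>.\<close>
      have "p dvd (\<Sum>i\<in>I. w v i * (\<Sum>u\<in>S. (c u - d u) * w u i))"
        using dvd by (intro dvd_sum) auto
      also have "(\<Sum>i\<in>I. w v i * (\<Sum>u\<in>S. (c u - d u) * w u i))
          = (\<Sum>u\<in>S. (c u - d u) * (\<Sum>i\<in>I. w u i * w v i))"
        by (simp add: sum_distrib_left mult_ac) (rule sum.swap)
      also have "\<dots> = (c v - d v) * (\<Sum>i\<in>I. w v i * w v i)
          + (\<Sum>u\<in>S-{v}. (c u - d u) * (\<Sum>i\<in>I. w u i * w v i))"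
        by (rule sum.remove[OF fin(1) v])
      finally have "p dvd (c v - d v) * (\<Sum>i\<in>I. w v i * w v i)
          + (\<Sum>u\<in>S-{v}. (c u - d u) * (\<Sum>i\<in>I. w u i * w v i))" .
      moreover have "p dvd (\<Sum>u\<in>S-{v}. (c u - d u) * (\<Sum>i\<in>I. w u i * w v i))"
        using v by (intro dvd_sum dvd_mult off) auto
      ultimately have "p dvd (c v - d v) * (\<Sum>i\<in>I. w v i * w v i)"
        by (simp add: dvd_add_left_iff)
      then have "p dvd c v - d v"
        using diag[OF v] p prime_dvd_mult_iff by blast
      moreover have "\<bar>c v - d v\<bar> < p"
        using PiE_mem[OF c v] PiE_mem[OF d v] by auto
      ultimately show "c v = d v"
        using zdvd_not_zless[of "\<bar>c v - d v\<bar>" p] by force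
    qed
  qed
  moreover have "\<Phi> ` (S \<rightarrow>\<^sub>E {0..<p}) \<subseteq> I \<rightarrow>\<^sub>E {0..<p}"
    using p1 by (auto simp: \<Phi>_def)
  ultimately have "card (S \<rightarrow>\<^sub>E {0..<p}) \<le> card (I \<rightarrow>\<^sub>E {0..<p})"
    by (intro card_inj_on_le) (auto intro!: finite_PiE fin)
  then have "nat p ^ card S \<le> nat p ^ card I"
    using fin by (simp add: card_PiE)
  then show ?thesis
    using p1 by (subst (asm) power_increasing_iff) auto
qed

text \<open>A modular version of Haemers' bound: representations tensorise over strong powers.\<close>

lemma shannon_capacity_le_of_orthogonal_mod_prime:
  fixes w :: "'v \<Rightarrow> 'i \<Rightarrow> int" and p :: int
  assumes fin: "finite (pverts G)" "finite I" and p: "prime p"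
    and diag: "\<And>u. u \<in> pverts G \<Longrightarrow> \<not> p dvd (\<Sum>i\<in>I. w u i * w u i)"
    and off: "\<And>u v. u \<in> pverts G \<Longrightarrow> v \<in> pverts G \<Longrightarrow> u \<noteq> v \<Longrightarrow> (u, v) \<notin> parcs G
                \<Longrightarrow> p dvd (\<Sum>i\<in>I. w u i * w v i)"
  shows "shannon_capacity G \<le> real (card I)"
proof -
  have bound: "independence_number (strong_power G k) \<le> card I ^ k" for k
  proof -
    obtain S where S: "independent_set (strong_power G k) S"
      "card S = independence_number (strong_power G k)"
      using ex_max_independent_set[OF finite_strong_power_verts[OF fin(1)]] by metis
    \<comment> \<open>\<open>W xs\<close> is the tensor product of the vectors of the entries of
      \<open>xs\<close>, so inner products multiply over the coordinates.\<close>
    define W where "W xs f = (\<Prod>j<k. w (xs ! j) (f j))" for xs and f :: "nat \<Rightarrow> 'i"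
    let ?J = "{..<k} \<rightarrow>\<^sub>E I"
    have inner: "(\<Sum>f\<in>?J. W xs f * W ys f) = (\<Prod>j<k. \<Sum>i\<in>I. w (xs ! j) i * w (ys ! j) i)" for xs ys
      using prod_sum_PiE[of "{..<k}" "\<lambda>_. I" "\<lambda>j i. w (xs ! j) i * w (ys ! j) i"] fin
      by (simp add: W_def prod.distrib)
    have SV: "length xs = k" "\<And>j. j < k \<Longrightarrow> xs ! j \<in> pverts G" if "xs \<in> S" for xs
      using S(1) that nth_mem by (fastforce simp: independent_set_def strong_power_def)+
    have "finite S"
      using S(1) finite_strong_power_verts[OF fin(1)] finite_subset
      by (auto simp: independent_set_def)
    then have "card S \<le> card ?J"
    proof (rule card_le_of_orthogonal_mod_prime[OF _ _ p])
      show "finite ?J" by (intro finite_PiE fin) auto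
      show "\<not> p dvd (\<Sum>f\<in>?J. W xs f * W xs f)" if "xs \<in> S" for xs
        unfolding inner using SV[OF that] diag p by (subst prime_dvd_prod_iff) auto
      show "p dvd (\<Sum>f\<in>?J. W xs f * W ys f)" if xy: "xs \<in> S" "ys \<in> S" "xs \<noteq> ys" for xs ys
      proof -
        have "(xs, ys) \<notin> parcs (strong_power G k)" "xs \<in> pverts (strong_power G k)"
          "ys \<in> pverts (strong_power G k)"
          using S(1) xy by (auto simp: independent_set_def)
        \<comment> \<open>One coordinate with distinct non-adjacent entries makes the whole product
          divisible by \<open>p\<close>.\<close>
        then obtain j where "j < k" "xs ! j \<noteq> ys ! j" "(xs ! j, ys ! j) \<notin> parcs G"
          using xy by (auto simp: strong_power_def Let_def)
        then show ?thesis
          unfolding inner using off SV xy p by (subst prime_dvd_prod_iff) (auto intro!: bexI[of _ j])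
      qed
    qed
    then show ?thesis using S by (simp add: card_PiE)
  qed
  have "real (independence_number (strong_power G k)) powr (1 / real k) \<le> real (card I)"
    if "k \<ge> 1" for k
  proof -
    have "real (independence_number (strong_power G k)) \<le> real (card I) ^ k"
      using bound[of k] by (metis of_nat_le_iff of_nat_power)
    then have "real (independence_number (strong_power G k)) powr (1 / real k)
        \<le> (real (card I) ^ k) powr (1 / real k)"
      by (intro powr_mono2) auto
    also have "\<dots> = real (card I)"
      using that by (cases "card I = 0") (auto simp: powr_realpow[symmetric] powr_powr)
    finally show ?thesis .
  qed
  then show ?thesis
    by (intro LIMSEQ_le_const2[OF shannon_capacity_LIMSEQ[OF fin(1)]]) auto
qed

lemma card_root_le_shannon_capacity:
  assumes "finite (pverts G)" "independent_set (strong_power G k) S" "k \<ge> 1"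
  shows "real (card S) powr (1 / real k) \<le> shannon_capacity G"
proof -
  have "real (card S) powr (1 / real k)
      \<le> real (independence_number (strong_power G k)) powr (1 / real k)"
    using card_le_independence_number[OF finite_strong_power_verts[OF assms(1)] assms(2)]
    by (intro powr_mono2) auto
  also have "\<dots> \<le> shannon_capacity G"
    unfolding shannon_capacity_eq_SUP[OF assms(1)]
    using assms by (intro cSUP_upper shannon_capacity_bdd_above) auto
  finally show ?thesis .
qed

text \<open>The independent set consists of the diagonal tuples \<open>((i, v))\<close>, \<open>i\<close> running through \<open>F\<close>.\<close>

lemma shannon_capacity_disjoint_graph_union_ge:
  assumes X: "finite X" "F \<subseteq> X" "F \<noteq> {}"
    and fin: "\<And>i. i \<in> X \<Longrightarrow> finite (pverts (G i))"
    and V: "\<And>i. i \<in> F \<Longrightarrow> V \<subseteq> pverts (G i)"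
    and sep: "\<And>u v. u \<in> V \<Longrightarrow> v \<in> V \<Longrightarrow> u \<noteq> v \<Longrightarrow> \<exists>i\<in>F. (u, v) \<notin> parcs (G i)"
  shows "real (card V) powr (1 / real (card F)) \<le> shannon_capacity (disjoint_graph_union X G)"
proof -
  obtain ls where ls: "set ls = F" "distinct ls"
    using finite_distinct_list finite_subset X by metis
  then have len: "length ls = card F" "length ls \<ge> 1"
    using X distinct_card[of ls] by (auto simp: Suc_le_eq)
  define \<Delta> where "\<Delta> v = map (\<lambda>i. (i, v)) ls" for v :: 'b
  have nth: "\<Delta> v ! j = (ls ! j, v)" if "j < length ls" for v j
    using that by (simp add: \<Delta>_def)
  have inj: "inj_on \<Delta> V"
  proof (rule inj_onI)
    fix u v assume "\<Delta> u = \<Delta> v"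
    then have "\<Delta> u ! 0 = \<Delta> v ! 0" by (rule arg_cong)
    moreover have "0 < length ls" using len(2) by linarith
    ultimately show "u = v" by (simp only: nth prod.inject)
  qed
  have "independent_set (strong_power (disjoint_graph_union X G) (length ls)) (\<Delta> ` V)"
    unfolding independent_set_def
  proof (intro conjI ballI)
    show "\<Delta> ` V \<subseteq> pverts (strong_power (disjoint_graph_union X G) (length ls))"
      using X V ls by (fastforce simp: \<Delta>_def strong_power_def disjoint_graph_union_def)
    fix a b assume "a \<in> \<Delta> ` V" "b \<in> \<Delta> ` V"
    then obtain u v where uv: "a = \<Delta> u" "b = \<Delta> v" "u \<in> V" "v \<in> V" by auto
    show "(a, b) \<notin> parcs (strong_power (disjoint_graph_union X G) (length ls))"
    proof (cases "u = v")
      case True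
      then show ?thesis using uv by (simp add: strong_power_def)
    next
      case False
      \<comment> \<open>In coordinate \<open>j\<close> both tuples lie in the copy of the same graph
        \<open>G (ls ! j)\<close>, where \<open>u\<close> and \<open>v\<close> are distinct and
        non-adjacent.\<close>
      then obtain j where "j < length ls" "(u, v) \<notin> parcs (G (ls ! j))"
        using sep uv ls by (metis in_set_conv_nth)
      then show ?thesis
        using uv False nth
        by (auto simp: strong_power_def disjoint_graph_union_def Let_def intro!: exI[of _ j])
    qed
  qed
  moreover have "finite (pverts (disjoint_graph_union X G))"
    using X fin by (auto simp: disjoint_graph_union_def)
  ultimately show ?thesis
    using card_root_le_shannon_capacity[of "disjoint_graph_union X G" "length ls" "\<Delta> ` V"] len
    by (simp add: card_image[OF inj])
qed

text \<open>Dimensions add over disjoint unions: \<open>W\<close> puts the vectors of each summand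
  into a block of its own in \<open>X \<times> I\<close>. Vertices of different summands are
  non-adjacent, and their vectors are orthogonal.\<close>

lemma shannon_capacity_disjoint_graph_union_le:
  fixes w :: "'j \<Rightarrow> 'v \<Rightarrow> 'i \<Rightarrow> int" and p :: int
  assumes fin: "finite X" "\<And>i. i \<in> X \<Longrightarrow> finite (pverts (G i))" "finite I" and p: "prime p"
    and diag: "\<And>i u. i \<in> X \<Longrightarrow> u \<in> pverts (G i) \<Longrightarrow> \<not> p dvd (\<Sum>k\<in>I. w i u k * w i u k)"
    and off: "\<And>i u v. i \<in> X \<Longrightarrow> u \<in> pverts (G i) \<Longrightarrow> v \<in> pverts (G i) \<Longrightarrow> u \<noteq> v
                \<Longrightarrow> (u, v) \<notin> parcs (G i) \<Longrightarrow> p dvd (\<Sum>k\<in>I. w i u k * w i v k)"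
  shows "shannon_capacity (disjoint_graph_union X G) \<le> real (card X * card I)"
proof -
  define W where "W a b = (if fst b = fst a then w (fst a) (snd a) (snd b) else 0)"
    for a :: "'j \<times> 'v" and b :: "'j \<times> 'i"
  have inner: "(\<Sum>b\<in>X\<times>I. W a b * W c b)
      = (if fst a = fst c then \<Sum>k\<in>I. w (fst a) (snd a) k * w (fst a) (snd c) k else 0)"
    if "fst a \<in> X" for a c
  proof -
    have "(\<Sum>b\<in>X\<times>I. W a b * W c b) = (\<Sum>i\<in>X. \<Sum>k\<in>I. W a (i, k) * W c (i, k))"
      by (simp add: sum.cartesian_product)
    also have "\<dots> = (\<Sum>i\<in>X. if i = fst a then \<Sum>k\<in>I. W a (i, k) * W c (i, k) else 0)"
      by (intro sum.cong) (auto simp: W_def)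
    also have "\<dots> = (\<Sum>k\<in>I. W a (fst a, k) * W c (fst a, k))"
      using that fin by simp
    finally show ?thesis by (simp add: W_def)
  qed
  have "shannon_capacity (disjoint_graph_union X G) \<le> real (card (X \<times> I))"
  proof (rule shannon_capacity_le_of_orthogonal_mod_prime[OF _ _ p])
    show "finite (pverts (disjoint_graph_union X G))" "finite (X \<times> I)"
      using fin by (auto simp: disjoint_graph_union_def)
    show "\<not> p dvd (\<Sum>b\<in>X\<times>I. W a b * W a b)" if "a \<in> pverts (disjoint_graph_union X G)" for a
      using that diag by (auto simp: inner disjoint_graph_union_def)
    show "p dvd (\<Sum>b\<in>X\<times>I. W a b * W c b)"
      if "a \<in> pverts (disjoint_graph_union X G)" "c \<in> pverts (disjoint_graph_union X G)"
        "a \<noteq> c" "(a, c) \<notin> parcs (disjoint_graph_union X G)" for a c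
      using that off[of "fst a" "snd a" "snd c"]
      by (cases a; cases c) (auto simp: inner disjoint_graph_union_def)
  qed
  then show ?thesis by (simp add: card_cartesian_product)
qed

section \<open>Binomial coefficients modulo a prime and set differences modulo a prime power\<close>

lemma prime_dvd_binomial_prime_power_diff_one:
  fixes p q m e :: nat
  assumes p: "prime p" and q: "q = p ^ e"
  shows "p dvd (m choose (q - 1)) \<longleftrightarrow> \<not> q dvd Suc m"
proof -
  have q0: "q > 0" using p q by (simp add: prime_gt_0_nat)
  have cancel: "p dvd b" if "q dvd a * b" "\<not> q dvd a" for a b
  proof (rule ccontr)
    assume "\<not> p dvd b"
    then have "coprime q b"
      unfolding q using p by (simp add: prime_imp_coprime)
    then show False using that coprime_dvd_mult_left_iff by blast
  qed
  show ?thesis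
  proof
    \<comment> \<open>Absorption identity: \<open>q\<close> divides the product, so if it does not
      divide \<open>Suc m\<close>, then \<open>p\<close> divides the binomial coefficient.\<close>
    have "Suc m * (m choose (q - 1)) = q * (Suc m choose q)"
      using Suc_times_binomial[of "q - 1" m] q0 by simp
    then show "p dvd (m choose (q - 1))" if "\<not> q dvd Suc m"
      using cancel[of "Suc m"] that by simp
  next
    assume dv: "p dvd (m choose (q - 1))"
    show "\<not> q dvd Suc m"
    proof
      assume qd: "q dvd Suc m"
      \<comment> \<open>Induction from \<open>m choose 0 = 1\<close>: for \<open>0 < j < q\<close>,
        \<open>p\<close> divides \<open>Suc m choose j\<close>, so by Pascal's rule consecutive
        \<open>m choose i\<close> agree up to sign modulo \<open>p\<close>.\<close>
      have "\<not> p dvd (m choose i)" if "i < q" for i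
        using that
      proof (induction i)
        case 0
        then show ?case using p by (simp add: prime_nat_iff)
      next
        case (Suc i)
        have "q dvd Suc i * (Suc m choose Suc i)"
          unfolding Suc_times_binomial using qd by (rule dvd_mult2)
        then have "p dvd (Suc m choose Suc i)"
          using Suc.prems by (intro cancel[of "Suc i"]) (auto dest: dvd_imp_le)
        then show ?case
          using Suc by (metis Suc_lessD binomial_Suc_Suc dvd_add_left_iff)
      qed
      then show False using q0 dv by simp
    qed
  qed
qed

text \<open>
  The vector of a set \<open>B\<close> is indexed by the \<open>(q - 1)\<close>-subsets \<open>K\<close> of the ground set enlarged by \<open>c\<close>
  dummy points and records whether \<open>K\<close> lies in the enlarged \<open>B\<close>, so that inner products are
  binomial coefficients; \<open>c\<close> is chosen with \<open>q dvd s + c + 1\<close>.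
\<close>

lemma shannon_capacity_disjoint_graph_union_sets_le:
  fixes A :: "'v \<Rightarrow> 'a set" and G :: "'j \<Rightarrow> 'v pair_pre_digraph" and p q e :: nat
  assumes fin: "finite X" "finite U" "\<And>i. i \<in> X \<Longrightarrow> finite (pverts (G i))"
    and p: "prime p" and q: "q = p ^ e"
    and A: "\<And>i v. i \<in> X \<Longrightarrow> v \<in> pverts (G i) \<Longrightarrow> A v \<subseteq> U \<and> card (A v) = s"
    and off: "\<And>i u v. i \<in> X \<Longrightarrow> u \<in> pverts (G i) \<Longrightarrow> v \<in> pverts (G i) \<Longrightarrow> u \<noteq> v
                \<Longrightarrow> (u, v) \<notin> parcs (G i) \<Longrightarrow> \<not> q dvd card (A u - A v)"
  shows "shannon_capacity (disjoint_graph_union X G)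
           \<le> real (card X * ((card U + q) choose (q - 1)))"
proof -
  have q0: "q > 0" using p q by (simp add: prime_gt_0_nat)
  define c where "c = q - 1 - s mod q"
  have c: "Suc (s + c) = q * (s div q) + q" "c < q"
    using mod_less_divisor[OF q0, of s] mult_div_mod_eq[of q s] unfolding c_def by linarith+
  define I where "I = {K. K \<subseteq> U <+> {..<c} \<and> card K = q - 1}"
  define w where "w v K = (if K \<subseteq> A v <+> {..<c} then 1 else 0 :: int)" for v and K :: "('a + nat) set"
  have finI: "finite I" using fin by (simp add: I_def)
  have finA: "finite (A v)" "A v \<subseteq> U" "card (A v) = s" if "i \<in> X" "v \<in> pverts (G i)" for i v
    using A[OF that] fin finite_subset by auto
  have inner: "(\<Sum>K\<in>I. w u K * w v K) = int ((card (A u \<inter> A v) + c) choose (q - 1))"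
    if "i \<in> X" "u \<in> pverts (G i)" "v \<in> pverts (G i)" for i u v
  proof -
    have "(\<Sum>K\<in>I. w u K * w v K) = (\<Sum>K\<in>I. if K \<subseteq> (A u \<inter> A v) <+> {..<c} then 1 else 0)"
      by (intro sum.cong) (auto simp: w_def)
    also have "\<dots> = int (card {K. K \<subseteq> (A u \<inter> A v) <+> {..<c} \<and> card K = q - 1})"
      using finI finA[OF that(1,2)]
      by (simp add: sum.If_cases) (rule arg_cong[where f = card], auto simp: I_def)
    also have "card {K. K \<subseteq> (A u \<inter> A v) <+> {..<c} \<and> card K = q - 1}
        = (card (A u \<inter> A v) + c) choose (q - 1)"
      using finA[OF that(1,2)] by (subst n_subsets) (auto simp: card_Plus)
    finally show ?thesis .
  qed
  have dvd_iff: "int p dvd (\<Sum>K\<in>I. w u K * w v K) \<longleftrightarrow> \<not> q dvd card (A u - A v)"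
    if "i \<in> X" "u \<in> pverts (G i)" "v \<in> pverts (G i)" for i u v
  proof -
    \<comment> \<open>As \<open>q\<close> divides \<open>s + c + 1\<close>, it divides
      \<open>card (A u \<inter> A v) + c + 1\<close> iff it divides \<open>card (A u - A v)\<close>.
      For \<open>u = v\<close> the difference is empty, which makes the diagonal entries nonzero
      modulo \<open>p\<close>.\<close>
    have "card (A u - A v) + card (A u \<inter> A v) = s"
      using finA[OF that(1,2)] by (metis card_Diff_subset_Int card_mono finite_Int inf_le1 le_add_diff_inverse2)
    then have "card (A u - A v) + Suc (card (A u \<inter> A v) + c) = q * (s div q) + q"
      using c by simp
    then have "q dvd Suc (card (A u \<inter> A v) + c) \<longleftrightarrow> q dvd card (A u - A v)"
      by (metis dvd_add_right_iff dvd_add_left_iff dvd_refl dvd_triv_left)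
    then show ?thesis
      unfolding inner[OF that] using prime_dvd_binomial_prime_power_diff_one[OF p q] by simp
  qed
  have "shannon_capacity (disjoint_graph_union X G) \<le> real (card X * card I)"
    by (rule shannon_capacity_disjoint_graph_union_le[where w = "\<lambda>_. w" and p = "int p"])
      (use fin finI p off in \<open>auto simp: dvd_iff\<close>)
  also have "card I = (card U + c) choose (q - 1)"
    using fin by (simp add: I_def n_subsets card_Plus)
  also have "real (card X * \<dots>) \<le> real (card X * ((card U + q) choose (q - 1)))"
    using c by (intro of_nat_mono mult_left_mono binomial_right_mono) auto
  finally show ?thesis .
qed

section \<open>Graphs attached to a family of qualified sets\<close>

lemma exists_privileged_graphs:
  fixes A :: "'v \<Rightarrow> 'a set" and q :: "'j set \<Rightarrow> nat" and \<F> :: "'j set set"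
  assumes fin: "finite T" "finite U" "finite V"
    and A: "inj_on A V" "\<And>v. v \<in> V \<Longrightarrow> A v \<subseteq> U \<and> card (A v) = s"
    and F: "{} \<notin> \<F>"
    and q: "\<And>Y. Y \<subseteq> T \<Longrightarrow> primepow (q Y)"
      "\<And>Y Z. Y \<subseteq> T \<Longrightarrow> Z \<subseteq> T \<Longrightarrow> Y \<noteq> Z \<Longrightarrow> coprime (q Y) (q Z) \<and> s < q Y * q Z"
  obtains G :: "'j \<Rightarrow> 'v pair_pre_digraph" where
    "\<And>i. pair_graph (G i)" "\<And>i. pverts (G i) = V"
    "\<And>X F. X \<subseteq> T \<Longrightarrow> F \<in> \<F> \<Longrightarrow> F \<subseteq> X \<Longrightarrow>
       real (card V) powr (1 / real (card F)) \<le> shannon_capacity (disjoint_graph_union X G)"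
    "\<And>X. X \<subseteq> T \<Longrightarrow> \<forall>F\<in>\<F>. \<not> F \<subseteq> X \<Longrightarrow>
       shannon_capacity (disjoint_graph_union X G)
         \<le> real (card X * ((card U + q X) choose (q X - 1)))"
proof -
  \<comment> \<open>\<open>free\<close> singles out the unqualified sets, the only colours that
    create edges.\<close>
  define free where "free Y \<longleftrightarrow> Y \<subseteq> T \<and> (\<forall>F\<in>\<F>. \<not> F \<subseteq> Y)" for Y
  define E where "E i u v \<longleftrightarrow> (\<exists>Y. free Y \<and> i \<in> Y \<and> q Y dvd card (A u - A v))" for i u v
  define G where "G i = \<lparr>pverts = V, parcs = {(u, v) \<in> V \<times> V. u \<noteq> v \<and> E i u v}\<rparr>" for i
  have finA: "finite (A v)" if "v \<in> V" for v
    using A(2)[OF that] fin finite_subset by blast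
  have sym: "card (A u - A v) = card (A v - A u)" if "u \<in> V" "v \<in> V" for u v
    using A(2) that finA by (metis card_le_sym_Diff le_antisym order_refl)
  have uniq: "Y = Z" if "free Y" "free Z" "q Y dvd card (A u - A v)" "q Z dvd card (A u - A v)"
    "u \<in> V" "v \<in> V" "u \<noteq> v" for Y Z u v
  proof (rule ccontr)
    assume "Y \<noteq> Z"
    then have *: "coprime (q Y) (q Z)" "s < q Y * q Z"
      using q(2) that by (auto simp: free_def)
    \<comment> \<open>Distinct vertices have distinct sets of the same finite size, so neither set
      contains the other.\<close>
    have nz: "card (A u - A v) > 0"
      unfolding neq0_conv[symmetric]
      using finA A that by (metis card_0_eq card_subset_eq finite_Diff Diff_eq_empty_iff inj_on_contraD)
    have "q Y * q Z dvd card (A u - A v)"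
      using * that by (simp add: divides_mult)
    then have "q Y * q Z \<le> card (A u - A v)" using nz by (rule dvd_imp_le)
    also have "card (A u - A v) \<le> s"
      using A(2)[OF that(5)] finA[OF that(5)] by (metis card_mono Diff_subset)
    finally show False using * by simp
  qed
  show ?thesis
  proof
    show "pair_graph (G i)" for i
      using fin sym by (auto simp: pair_graph_iff G_def E_def sym_def irrefl_def)
    show "pverts (G i) = V" for i by (simp add: G_def)
    show "real (card V) powr (1 / real (card F)) \<le> shannon_capacity (disjoint_graph_union X G)"
      if X: "X \<subseteq> T" "F \<in> \<F>" "F \<subseteq> X" for X F
    proof (rule shannon_capacity_disjoint_graph_union_ge)
      show "finite X" using X fin finite_subset by blast
      show "\<exists>i\<in>F. (u, v) \<notin> parcs (G i)" if uv: "u \<in> V" "v \<in> V" "u \<noteq> v" for u v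
      proof (rule ccontr)
        assume "\<not> (\<exists>i\<in>F. (u, v) \<notin> parcs (G i))"
        then have *: "\<exists>Y. free Y \<and> i \<in> Y \<and> q Y dvd card (A u - A v)" if "i \<in> F" for i
          using that by (auto simp: G_def E_def)
        \<comment> \<open>All edges between \<open>u\<close> and \<open>v\<close> come from the same
          \<open>Y\<close>, so \<open>Y\<close> contains the whole of \<open>F\<close>, which
          contradicts \<open>free Y\<close>. \<open>{} \<notin> \<F>\<close> supplies
          \<open>i0\<close>.\<close>
        obtain i0 where "i0 \<in> F" using X F by fastforce
        then obtain Y where Y: "free Y" "q Y dvd card (A u - A v)" using * by blast
        then have "F \<subseteq> Y" using * uniq[OF _ Y(1) _ Y(2)] uv by blast
        then show False using Y X by (auto simp: free_def)
      qed
    qed (use X F fin in \<open>auto simp: G_def\<close>)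
    show "shannon_capacity (disjoint_graph_union X G)
         \<le> real (card X * ((card U + q X) choose (q X - 1)))"
      if X: "X \<subseteq> T" "\<forall>F\<in>\<F>. \<not> F \<subseteq> X" for X
    proof -
      have "primepow (q X)" using q X by blast
      then obtain p e where "prime p" "q X = p ^ e" by (auto simp: primepow_def)
      then show ?thesis
      proof (rule shannon_capacity_disjoint_graph_union_sets_le[rotated 3, where A = A and s = s])
        show "finite X" using X fin finite_subset by blast
        \<comment> \<open>\<open>X\<close> itself is free, so divisibility by \<open>q X\<close>
          would make the pair an edge of every \<open>G i\<close> with
          \<open>i \<in> X\<close>.\<close>
        show "\<not> q X dvd card (A u - A v)"
          if "i \<in> X" "u \<in> pverts (G i)" "v \<in> pverts (G i)" "u \<noteq> v" "(u, v) \<notin> parcs (G i)" for i u v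
          using that X by (auto simp: G_def E_def free_def)
      qed (use fin A in \<open>auto simp: G_def\<close>)
    qed
  qed
qed

section \<open>The Dirichlet series of the Mangoldt function\<close>

lemma norm_of_nat_powr: "norm (of_nat n powr s :: complex) = real n powr Re s"
  by (simp add: norm_powr_real_powr)

lemma holomorphic_on_of_nat_powr [holomorphic_intros]:
  "f holomorphic_on S \<Longrightarrow> (\<lambda>s. of_nat n powr f s :: complex) holomorphic_on S"
  by (cases "n = 0") (auto intro!: holomorphic_intros)

text \<open>The sum starts at \<open>n = 0\<close>, where \<open>0 powr z = 0\<close>; for
  \<open>Re s > 1\<close> this is the Riemann zeta function, and \<open>mangoldt_series\<close> is
  its negated logarithmic derivative.\<close>

definition zeta_series :: "complex \<Rightarrow> complex" where
  "zeta_series s = (\<Sum>n. of_nat n powr (-s))"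

definition mangoldt_series :: "complex \<Rightarrow> complex" where
  "mangoldt_series s = (\<Sum>n. mangoldt n * of_nat n powr (-s))"

lemma mangoldt_le_ln: "mangoldt n \<le> ln (real n)"
proof (cases "n = 0")
  case False
  have "mangoldt n \<le> (\<Sum>d | d dvd n. mangoldt d :: real)"
    using False by (intro member_le_sum) (auto simp: mangoldt_nonneg)
  then show ?thesis using mangoldt_sum[of n, where 'a = real] False by simp
qed auto

text \<open>The common majorant of the Dirichlet series used here, whose coefficients
  \<open>1\<close>, \<open>mangoldt n\<close> and \<open>mangoldt n - 1\<close> are at most
  \<open>ln n + 1\<close> in modulus. Half of the excess \<open>\<sigma> - 1\<close> absorbs the
  logarithm.\<close>

lemma summable_ln_powr:
  assumes "\<sigma> > 1"
  shows "summable (\<lambda>n. (ln (real n) + 1) * real n powr (-\<sigma>))"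
proof (rule summable_comparison_test)
  define d where "d = (\<sigma> - 1) / 2"
  have d: "d > 0" "d - \<sigma> < -1" using assms by (auto simp: d_def field_simps)
  show "summable (\<lambda>n. (1 / d + 1) * real n powr (d - \<sigma>))"
    using d by (intro summable_mult) (simp add: summable_real_powr_iff)
  show "\<exists>N. \<forall>n\<ge>N. norm ((ln (real n) + 1) * real n powr (-\<sigma>)) \<le> (1 / d + 1) * real n powr (d - \<sigma>)"
  proof (intro exI[of _ 1] allI impI)
    fix n :: nat assume n: "n \<ge> 1"
    have "ln (real n) + 1 \<le> real n powr d / d + real n powr d"
      using n d ln_powr_bound[of "real n" d] by (intro add_mono) (auto simp: ge_one_powr_ge_zero)
    also have "\<dots> = (1 / d + 1) * real n powr d" by (simp add: algebra_simps)
    finally have "(ln (real n) + 1) * real n powr (-\<sigma>) \<le> (1 / d + 1) * real n powr d * real n powr (-\<sigma>)"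
      by (intro mult_right_mono) auto
    then show "norm ((ln (real n) + 1) * real n powr (-\<sigma>)) \<le> (1 / d + 1) * real n powr (d - \<sigma>)"
      using n by (simp add: powr_diff powr_minus field_simps)
  qed
qed

lemma norm_summable_dirichlet:
  assumes "\<And>n. norm (c n) \<le> ln (real n) + 1" "Re s > 1"
  shows "summable (\<lambda>n. norm (c n * of_nat n powr (-s) :: complex))"
  by (rule summable_comparison_test'[OF summable_ln_powr[OF assms(2)], of 0])
    (use assms in \<open>auto simp: norm_mult norm_of_nat_powr intro!: mult_right_mono\<close>)

lemma ln_of_nat_nonneg: "ln (real n) \<ge> 0"
  by (cases "n = 0") auto

lemma has_sum_zeta_series:
  assumes "Re s > 1"
  shows "((\<lambda>n. of_nat n powr (-s)) has_sum zeta_series s) UNIV"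
  using norm_summable_dirichlet[of "\<lambda>_. 1" s] assms ln_of_nat_nonneg
  by (intro norm_summable_imp_has_sum)
    (auto simp: zeta_series_def intro!: summable_sums summable_norm_cancel)

lemma has_sum_mangoldt_series:
  assumes "Re s > 1"
  shows "((\<lambda>n. mangoldt n * of_nat n powr (-s)) has_sum mangoldt_series s) UNIV"
proof -
  have "norm (mangoldt n :: complex) \<le> ln (real n) + 1" for n
    using mangoldt_le_ln[of n] by simp
  from norm_summable_dirichlet[OF this assms] show ?thesis
    by (intro norm_summable_imp_has_sum)
      (auto simp: mangoldt_series_def intro!: summable_sums summable_norm_cancel)
qed

lemma zeta_series_has_field_derivative_ln:
  assumes s: "Re s > 1"
  shows "\<exists>d. (zeta_series has_field_derivative -d) (at s) \<and>
             (\<lambda>n. of_real (ln (real n)) * of_nat n powr (-s)) sums d"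
proof -
  \<comment> \<open>The midpoint between \<open>1\<close> and \<open>Re s\<close>: the half-plane
    \<open>S\<close> contains \<open>s\<close> and still has a uniform summable majorant.\<close>
  define \<sigma> where "\<sigma> = (1 + Re s) / 2"
  have \<sigma>: "\<sigma> > 1" "Re s > \<sigma>" using s by (auto simp: \<sigma>_def field_simps)
  define S where "S = {z. Re z > \<sigma>}"
  have op: "open S" by (simp add: S_def open_halfspace_Re_gt)
  have sm: "summable (\<lambda>n. real n powr (-\<sigma>))" using \<sigma> by (simp add: summable_real_powr_iff)
  have der: "((\<lambda>x. of_nat n powr (-x)) has_field_derivative
      - (of_real (ln (real n)) * of_nat n powr (-x))) (at x)" for n and x :: complex
  proof (cases "n = 0")
    case False
    then have "((\<lambda>x. of_nat n powr (-x)) has_field_derivative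
        Ln (of_nat n) * of_nat n powr (-x) * (-1)) (at x)"
      by (intro DERIV_chain2[OF has_field_derivative_powr_right]) (auto intro!: derivative_eq_intros)
    then show ?thesis using False by simp
  qed auto
  have le: "\<forall>\<^sub>F n in sequentially. \<forall>x\<in>S. norm (of_nat n powr (-x) :: complex) \<le> real n powr (-\<sigma>)"
    using eventually_ge_at_top[of 1]
    by eventually_elim (auto simp: norm_of_nat_powr S_def intro!: powr_mono)
  obtain g g' where "\<forall>x\<in>S. ((\<lambda>n. of_nat n powr (-x)) sums g x) \<and>
      ((\<lambda>n. - (of_real (ln (real n)) * of_nat n powr (-x))) sums g' x) \<and>
      (g has_field_derivative g' x) (at x)"
    by (rule series_and_derivative_comparison[OF op sm der le])
  then have g: "\<And>x. x \<in> S \<Longrightarrow> (\<lambda>n. of_nat n powr (-x)) sums g x"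
    "\<And>x. x \<in> S \<Longrightarrow> (\<lambda>n. - (of_real (ln (real n)) * of_nat n powr (-x))) sums g' x"
    "\<And>x. x \<in> S \<Longrightarrow> (g has_field_derivative g' x) (at x)"
    by blast+
  have sS: "s \<in> S" using \<sigma> by (simp add: S_def)
  have "(zeta_series has_field_derivative g' s) (at s)"
  proof (rule has_field_derivative_transform_within_open[OF g(3)[OF sS] op])
    show "g x = zeta_series x" if "x \<in> S" for x
      using g(1)[OF that] by (simp add: zeta_series_def sums_iff)
  qed (use sS in auto)
  then show ?thesis
    using sums_minus[OF g(2)[OF sS]] by (intro exI[of _ "- g' s"]) simp
qed

text \<open>The Dirichlet series form of \<open>\<Lambda> * 1 = ln\<close>.\<close>

lemma zeta_series_has_field_derivative:
  assumes s: "Re s > 1"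
  shows "(zeta_series has_field_derivative - (mangoldt_series s * zeta_series s)) (at s)"
proof -
  define f where "f a = mangoldt a * of_nat a powr (-s)" for a :: nat
  define g where "g b = of_nat b powr (-s)" for b :: nat
  have f: "(f has_sum mangoldt_series s) UNIV" and g: "(g has_sum zeta_series s) UNIV"
    using has_sum_mangoldt_series[OF s] has_sum_zeta_series[OF s] unfolding f_def g_def by blast+
  have "norm (mangoldt n :: complex) \<le> ln (real n) + 1" for n
    using mangoldt_le_ln[of n] by simp
  from norm_summable_dirichlet[OF this s] have nf: "(\<lambda>a. norm (f a)) summable_on UNIV"
    unfolding f_def by (intro norm_summable_imp_summable_on) auto
  have ng: "(\<lambda>b. norm (g b)) summable_on UNIV"
    using norm_summable_dirichlet[of "\<lambda>_. 1", OF _ s] ln_of_nat_nonneg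
    unfolding g_def by (intro norm_summable_imp_summable_on) auto
  have "(\<lambda>(a, b). norm (f a) * norm (g b)) summable_on UNIV \<times> UNIV"
    by (rule summable_on_SigmaI[OF _ summable_on_cmult_left[OF nf, of "\<Sum>\<^sub>\<infinity>b. norm (g b)"]])
      (auto intro!: has_sum_cmult_right has_sum_infsum ng)
  then have sm: "(\<lambda>(a, b). f a * g b) summable_on UNIV \<times> UNIV"
    by (rule abs_summable_summable[OF summable_on_cong[THEN iffD1, rotated]]) (auto simp: norm_mult)
  have prod: "((\<lambda>(a, b). f a * g b) has_sum (mangoldt_series s * zeta_series s)) (UNIV \<times> UNIV)"
  proof (rule has_sum_SigmaI[OF _ has_sum_cmult_left[OF f] sm])
    show "((\<lambda>y. case (a, y) of (a, b) \<Rightarrow> f a * g b) has_sum (f a * zeta_series s)) UNIV" for a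
      using has_sum_cmult_right[OF g, of "f a"] by simp
  qed
  \<comment> \<open>Pairs with a zero entry contribute nothing; without them
    \<open>(a, b) \<mapsto> (a * b, a)\<close> is a bijection onto the pairs of a positive
    \<open>n\<close> and a divisor of \<open>n\<close>.\<close>
  have "((\<lambda>(a, b). f a * g b) has_sum (mangoldt_series s * zeta_series s)) (UNIV \<times> UNIV) \<longleftrightarrow>
      ((\<lambda>(a, b). f a * g b) has_sum (mangoldt_series s * zeta_series s)) ({0<..} \<times> {0<..})"
    by (rule has_sum_cong_neutral) (auto simp: f_def g_def)
  with prod have "((\<lambda>(a, b). f a * g b) has_sum (mangoldt_series s * zeta_series s)) ({0<..} \<times> {0<..})"
    by blast
  moreover have "((\<lambda>(a, b). f a * g b) has_sum (mangoldt_series s * zeta_series s)) ({0<..} \<times> {0<..}) \<longleftrightarrow>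
      ((\<lambda>(n, d). f d * g (n div d)) has_sum (mangoldt_series s * zeta_series s))
      (SIGMA n:{0<..}. {d. d dvd n})"
    by (rule has_sum_reindex_bij_witness[of _ "\<lambda>(n, d). (d, n div d)" "\<lambda>(a, b). (a * b, a)"])
      (auto simp: dvd_div_eq_0_iff intro!: Nat.gr0I)
  ultimately have "((\<lambda>(n, d). f d * g (n div d)) has_sum (mangoldt_series s * zeta_series s))
      (SIGMA n:{0<..}. {d. d dvd n})"
    by blast
  then have "((\<lambda>n. \<Sum>d | d dvd n. f d * g (n div d)) has_sum (mangoldt_series s * zeta_series s)) {0<..}"
    by (rule has_sum_SigmaD) (simp add: has_sum_finite)
  moreover have "(\<Sum>d | d dvd n. f d * g (n div d)) = of_real (ln (real n)) * of_nat n powr (-s)"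
    if n: "n > 0" for n
  proof -
    have "f d * g (n div d) = mangoldt d * of_nat n powr (-s)" if "d dvd n" for d
    proof -
      have "of_nat n powr (-s) = (of_nat d * of_nat (n div d) :: complex) powr (-s)"
        using that by (metis dvd_mult_div_cancel of_nat_mult)
      also have "\<dots> = of_nat d powr (-s) * of_nat (n div d) powr (-s)"
        by (intro powr_times_real) auto
      finally show ?thesis by (simp add: f_def g_def)
    qed
    then have "(\<Sum>d | d dvd n. f d * g (n div d)) = (\<Sum>d | d dvd n. mangoldt d) * of_nat n powr (-s)"
      by (simp add: sum_distrib_right)
    then show ?thesis using mangoldt_sum[of n, where 'a = complex] n by simp
  qed
  ultimately have "((\<lambda>n. of_real (ln (real n)) * of_nat n powr (-s)) has_sum
      (mangoldt_series s * zeta_series s)) {0<..}"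
    by (rule has_sum_cong[THEN iffD1, rotated]) simp
  moreover have "((\<lambda>n. of_real (ln (real n)) * of_nat n powr (-s)) has_sum
      (mangoldt_series s * zeta_series s)) {0<..} \<longleftrightarrow>
      ((\<lambda>n. of_real (ln (real n)) * of_nat n powr (-s)) has_sum
      (mangoldt_series s * zeta_series s)) UNIV"
    by (rule has_sum_cong_neutral) auto
  ultimately have "((\<lambda>n. of_real (ln (real n)) * of_nat n powr (-s)) has_sum
      (mangoldt_series s * zeta_series s)) UNIV"
    by blast
  then have "(\<lambda>n. of_real (ln (real n)) * of_nat n powr (-s)) sums (mangoldt_series s * zeta_series s)"
    by (rule has_sum_imp_sums)
  then show ?thesis
    using zeta_series_has_field_derivative_ln[OF s] sums_unique2 by metis
qed

section \<open>Continuation of \<open>(s - 1) \<zeta>(s)\<close> to \<open>Re s > 0\<close>\<close>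

text \<open>
  Telescoping \<open>1 = (\<Sum>n\<ge>1. n powr (1 - s) - (n + 1) powr (1 - s))\<close> turns \<open>(s - 1) \<zeta>(s)\<close> into the
  series below, which converges for \<open>Re s > 0\<close>. The term for \<open>n = 0\<close> is \<open>1\<close>, since \<open>0 powr z = 0\<close>.
\<close>

definition zeta_term :: "nat \<Rightarrow> complex \<Rightarrow> complex" where
  "zeta_term n s = (s - 1) * of_nat n powr (-s) - of_nat n powr (1 - s) + of_nat (Suc n) powr (1 - s)"

definition pole_free_zeta :: "complex \<Rightarrow> complex" where
  "pole_free_zeta s = (\<Sum>n. zeta_term n s)"

text \<open>\<open>zeta_term n s\<close> is the first-order Taylor remainder of
  \<open>x powr (1 - s)\<close> between \<open>n\<close> and \<open>n + 1\<close>; the second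
  derivative is \<open>s (s - 1) x powr (- s - 1)\<close>, largest in modulus at
  \<open>x = n\<close>.\<close>

lemma norm_zeta_term_le:
  assumes "n \<ge> 1" "Re s > 0"
  shows "norm (zeta_term n s) \<le> norm (s - 1) * norm s * real n powr (- Re s - 1)"
proof -
  define S where "S = complex_of_real ` {real n..}"
  define f where "f i x = (if i = 0 then x powr (1 - s) else if i = Suc 0 then (1 - s) * x powr (-s)
     else (1 - s) * (-s * x powr (-s - 1)))" for i :: nat and x :: complex
  have nonneg: "x \<notin> \<real>\<^sub>\<le>\<^sub>0" if "x \<in> S" for x
    using that assms by (auto simp: S_def complex_nonpos_Reals_iff)
  have "norm (f 0 (of_nat (Suc n)) - (\<Sum>i\<le>1. f i (of_nat n) * (of_nat (Suc n) - of_nat n) ^ i / fact i))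
      \<le> (norm (s - 1) * norm s * real n powr (- Re s - 1)) * norm (of_nat (Suc n) - of_nat n :: complex) ^ Suc 1 / fact 1"
  proof (rule complex_Taylor)
    show "convex S" unfolding S_def
      by (intro convex_linear_image bounded_linear.linear bounded_linear_of_real) auto
    show "(f i has_field_derivative f (Suc i) x) (at x within S)" if "x \<in> S" "i \<le> 1" for i x
    proof -
      have *: "((\<lambda>z. z powr w) has_field_derivative w * x powr (w - 1)) (at x within S)" for w
        using has_field_derivative_powr[OF nonneg[OF that(1)]] has_field_derivative_at_within by blast
      have "i = 0 \<or> i = 1" using that by auto
      then show ?thesis
        using *[of "1 - s"] DERIV_cmult[OF *[of "-s"], of "1 - s"]
        by (auto simp: f_def[abs_def])
    qed
    show "norm (f (Suc 1) x) \<le> norm (s - 1) * norm s * real n powr (- Re s - 1)" if xS: "x \<in> S" for x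
    proof -
      obtain y where y: "x = of_real y" "y \<ge> real n" using xS by (auto simp: S_def)
      have "y powr (- Re s - 1) \<le> real n powr (- Re s - 1)"
        using y assms by (intro powr_mono2') auto
      then show ?thesis
        using y assms by (auto simp: f_def norm_mult norm_powr_real_powr norm_minus_commute mult.assoc
          intro!: mult_left_mono)
    qed
    show "of_nat n \<in> S" unfolding S_def by (rule image_eqI[of _ _ "real n"]) auto
    show "of_nat (Suc n) \<in> S" unfolding S_def by (rule image_eqI[of _ _ "real (Suc n)"]) auto
  qed
  also have "f 0 (of_nat (Suc n)) - (\<Sum>i\<le>1. f i (of_nat n) * (of_nat (Suc n) - of_nat n) ^ i / fact i)
      = zeta_term n s"
    by (simp add: f_def zeta_term_def algebra_simps)
  finally show ?thesis by simp
qed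

lemma holomorphic_pole_free_zeta: "pole_free_zeta holomorphic_on {s. Re s > 0}"
proof (rule holomorphic_uniform_sequence)
  show op: "open {s. Re s > 0}" by (rule open_halfspace_Re_gt)
  show "(\<lambda>s. \<Sum>i<n. zeta_term i s) holomorphic_on {s. Re s > 0}" for n
    unfolding zeta_term_def by (intro holomorphic_intros)
  fix z :: complex assume z: "z \<in> {s. Re s > 0}"
  then have "Re z / 2 > 0" by simp
  moreover have Re_ge: "Re y \<ge> Re z / 2" if "y \<in> cball z (Re z / 2)" for y
    using that abs_Re_le_cmod[of "z - y"] by (auto simp: dist_norm)
  moreover have "uniform_limit (cball z (Re z / 2)) (\<lambda>n s. \<Sum>i<n. zeta_term i s) pole_free_zeta sequentially"
    unfolding pole_free_zeta_def
  proof (rule Weierstrass_m_test_ev)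
    \<comment> \<open>\<open>C\<close> bounds both \<open>norm s\<close> and
      \<open>norm (s - 1)\<close> on the ball, whose radius keeps
      \<open>Re s \<ge> Re z / 2\<close>.\<close>
    define C where "C = norm z + Re z / 2 + 1"
    show "summable (\<lambda>n. C * C * real n powr (- (Re z / 2) - 1))"
      using z by (intro summable_mult) (simp add: summable_real_powr_iff)
    show "\<forall>\<^sub>F n in sequentially. \<forall>s\<in>cball z (Re z / 2).
        norm (zeta_term n s) \<le> C * C * real n powr (- (Re z / 2) - 1)"
      using eventually_ge_at_top[of 1]
    proof eventually_elim
      case (elim n)
      show ?case
      proof
        fix s assume s: "s \<in> cball z (Re z / 2)"
        have "norm s \<le> norm z + norm (z - s)"
          by (metis norm_triangle_sub norm_minus_commute)
        then have 1: "norm s \<le> C" "norm (s - 1) \<le> C"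
          using s norm_triangle_ineq4[of s 1] by (auto simp: C_def dist_norm)
        have "norm (zeta_term n s) \<le> norm (s - 1) * norm s * real n powr (- Re s - 1)"
          using z Re_ge[OF s] elim by (intro norm_zeta_term_le) auto
        also have "\<dots> \<le> C * C * real n powr (- (Re z / 2) - 1)"
          using 1 elim Re_ge[OF s] by (intro mult_mono powr_mono) (auto intro: order_trans[OF norm_ge_zero])
        finally show "norm (zeta_term n s) \<le> C * C * real n powr (- (Re z / 2) - 1)" .
      qed
    qed
  qed
  ultimately show "\<exists>d>0. cball z d \<subseteq> {s. Re s > 0} \<and>
      uniform_limit (cball z d) (\<lambda>n s. \<Sum>i<n. zeta_term i s) pole_free_zeta sequentially"
    by (intro exI[of _ "Re z / 2"]) (fastforce simp del: mem_cball)
qed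

lemma pole_free_zeta_1: "pole_free_zeta 1 = 1"
proof -
  \<comment> \<open>The powers \<open>n powr 0\<close> and \<open>Suc n powr 0\<close> cancel except
    for \<open>n = 0\<close>, because \<open>0 powr 0 = 0\<close>.\<close>
  have "zeta_term n 1 = (if n = 0 then 1 else 0)" for n
    using of_nat_neq_0[of n, where 'a = complex] by (simp add: zeta_term_def)
  then show ?thesis by (simp add: pole_free_zeta_def sums_single[THEN sums_unique, symmetric])
qed

lemma pole_free_zeta_eq:
  assumes s: "Re s > 1"
  shows "pole_free_zeta s = (s - 1) * zeta_series s"
proof -
  have "(\<lambda>n. of_nat n powr (-s)) sums zeta_series s"
    using has_sum_zeta_series[OF s] by (rule has_sum_imp_sums)
  then have 1: "(\<lambda>n. (s - 1) * of_nat n powr (-s)) sums ((s - 1) * zeta_series s)"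
    by (rule sums_mult)
  have "(\<lambda>n. real n powr (1 - Re s)) \<longlonglongrightarrow> 0"
    using tendsto_neg_powr[of "1 - Re s" "\<lambda>n. real n"] s filterlim_real_sequentially by auto
  then have "(\<lambda>n. of_nat n powr (1 - s) :: complex) \<longlonglongrightarrow> 0"
    by (subst tendsto_norm_zero_iff[symmetric]) (simp add: norm_of_nat_powr)
  \<comment> \<open>The telescoping part sums to \<open>0\<close>: the powers tend to
    \<open>0\<close>, and \<open>0 powr (1 - s) = 0\<close>.\<close>
  then have "(\<lambda>n. of_nat (Suc n) powr (1 - s) - of_nat n powr (1 - s)) sums (0 - of_nat 0 powr (1 - s) :: complex)"
    by (rule telescope_sums)
  from sums_add[OF 1 this] have "(\<lambda>n. zeta_term n s) sums ((s - 1) * zeta_series s)"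
    by (simp add: zeta_term_def algebra_simps)
  then show ?thesis by (simp add: pole_free_zeta_def sums_iff)
qed

section \<open>The logarithmic derivative and non-vanishing on the line
  \<open>Re s = 1\<close>\<close>

lemma deriv_pole_free_zeta:
  assumes s: "Re s > 1"
  shows "deriv pole_free_zeta s = pole_free_zeta s * (1 / (s - 1) - mangoldt_series s)"
proof -
  have "((\<lambda>s. (s - 1) * zeta_series s) has_field_derivative
      zeta_series s + (s - 1) * - (mangoldt_series s * zeta_series s)) (at s)"
    by (rule derivative_eq_intros zeta_series_has_field_derivative[OF s] refl | simp)+
  then have "(pole_free_zeta has_field_derivative
      zeta_series s + (s - 1) * - (mangoldt_series s * zeta_series s)) (at s)"
    by (rule has_field_derivative_transform_within_open[where S = "{s. Re s > 1}"])
      (use s in \<open>auto simp: open_halfspace_Re_gt pole_free_zeta_eq\<close>)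
  moreover have "s \<noteq> 1" using s by auto
  ultimately show ?thesis
    using s by (simp add: DERIV_imp_deriv pole_free_zeta_eq field_simps)
qed

lemma log_deriv_pole_free_zeta:
  assumes "Re s > 1" "pole_free_zeta s \<noteq> 0"
  shows "deriv pole_free_zeta s / pole_free_zeta s = 1 / (s - 1) - mangoldt_series s"
  using deriv_pole_free_zeta[OF assms(1)] assms(2) by simp

text \<open>With \<open>k\<close> the order of vanishing at \<open>\<xi>\<close>,
  \<open>f w = (w - \<xi>) ^ k * g w\<close> with \<open>g\<close> zero-free nearby, so
  \<open>(w - \<xi>) f' / f = k + (w - \<xi>) g' / g\<close>. The point \<open>z\<close> excludes
  that \<open>f\<close> vanishes identically.\<close>

lemma tendsto_log_deriv_order:
  assumes holf: "f holomorphic_on S" and S: "open S" "connected S" "\<xi> \<in> S"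
    and nz: "z \<in> S" "f z \<noteq> 0"
  obtains k :: nat where "((\<lambda>w. (w - \<xi>) * (deriv f w / f w)) \<longlongrightarrow> of_nat k) (at \<xi>)"
    "f \<xi> = 0 \<longleftrightarrow> k > 0" "\<forall>\<^sub>F w in at \<xi>. f w \<noteq> 0"
proof -
  obtain g r k where r: "0 < r" "ball \<xi> r \<subseteq> S" and g: "g holomorphic_on ball \<xi> r"
    "\<And>w. w \<in> ball \<xi> r \<Longrightarrow> f w = (w - \<xi>) ^ k * g w" "\<And>w. w \<in> ball \<xi> r \<Longrightarrow> g w \<noteq> 0"
    and k: "f \<xi> = 0 \<longleftrightarrow> k > 0"
  proof (cases "f \<xi> = 0")
    case True
    then have "\<not> f constant_on S"
      using nz S by (metis constant_on_def)
    from holomorphic_factor_zero_nonconstant[OF holf S True this] show ?thesis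
      using that True by metis
  next
    case False
    have "continuous (at \<xi>) f"
      using holf S holomorphic_on_imp_continuous_on continuous_on_eq_continuous_at by blast
    then obtain e where e: "e > 0" "\<And>w. w \<in> ball \<xi> e \<Longrightarrow> f w \<noteq> 0"
      using continuous_at_avoid[of \<xi> f 0] False by (auto simp: dist_commute)
    obtain d where d: "d > 0" "ball \<xi> d \<subseteq> S" using S open_contains_ball by blast
    have "ball \<xi> (min d e) \<subseteq> S" using d by auto
    then show ?thesis
      using d e False holomorphic_on_subset[OF holf] by (intro that[of "min d e" f 0]) auto
  qed
  have near: "\<forall>\<^sub>F w in at \<xi>. w \<in> ball \<xi> r \<and> w \<noteq> \<xi>"
    using r by (intro eventually_conj eventually_at_in_open' eventually_neq_at_within) auto
  have g': "deriv g holomorphic_on ball \<xi> r" using g by (intro holomorphic_deriv) auto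
  have eq: "(w - \<xi>) * (deriv f w / f w) = of_nat k + (w - \<xi>) * (deriv g w / g w)"
    if w: "w \<in> ball \<xi> r" "w \<noteq> \<xi>" for w
  proof -
    have dg: "(g has_field_derivative deriv g w) (at w)"
      using g w holomorphic_derivI by blast
    have "((\<lambda>w. (w - \<xi>) ^ k * g w) has_field_derivative
        of_nat k * (w - \<xi>) ^ (k - 1) * g w + (w - \<xi>) ^ k * deriv g w) (at w)"
      by (rule derivative_eq_intros dg refl | simp)+
    then have "(f has_field_derivative
        of_nat k * (w - \<xi>) ^ (k - 1) * g w + (w - \<xi>) ^ k * deriv g w) (at w)"
      by (rule has_field_derivative_transform_within_open[where S = "ball \<xi> r"]) (use w g in auto)
    then have "deriv f w = of_nat k * (w - \<xi>) ^ (k - 1) * g w + (w - \<xi>) ^ k * deriv g w"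
      by (rule DERIV_imp_deriv)
    moreover have "a * ((of_nat k * a ^ (k - 1) * G + a ^ k * D) / (a ^ k * G)) = of_nat k + a * (D / G)"
      if "a \<noteq> 0" "G \<noteq> 0" for a D G :: complex
      using that by (cases k) (auto simp: field_simps)
    from this[of "w - \<xi>" "g w" "deriv g w"] have "(w - \<xi>) * ((of_nat k * (w - \<xi>) ^ (k - 1) * g w
        + (w - \<xi>) ^ k * deriv g w) / ((w - \<xi>) ^ k * g w)) = of_nat k + (w - \<xi>) * (deriv g w / g w)"
      using w g(3)[OF w(1)] by simp
    ultimately show ?thesis by (simp only: g(2)[OF w(1)])
  qed
  have "isCont g \<xi>" "isCont (deriv g) \<xi>"
    using g g' r by (metis holomorphic_on_imp_continuous_on continuous_on_eq_continuous_at open_ball centre_in_ball)+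
  then have "((\<lambda>w. of_nat k + (w - \<xi>) * (deriv g w / g w)) \<longlongrightarrow> of_nat k + (\<xi> - \<xi>) * (deriv g \<xi> / g \<xi>)) (at \<xi>)"
    using g r by (intro tendsto_intros) (auto simp: isCont_def)
  then have "((\<lambda>w. of_nat k + (w - \<xi>) * (deriv g w / g w)) \<longlongrightarrow> of_nat k) (at \<xi>)"
    by simp
  then have "((\<lambda>w. (w - \<xi>) * (deriv f w / f w)) \<longlongrightarrow> of_nat k) (at \<xi>)"
    by (rule Lim_transform_eventually) (use near in eventually_elim, use eq in auto)
  moreover have "\<forall>\<^sub>F w in at \<xi>. f w \<noteq> 0"
    using near by eventually_elim (use g in auto)
  ultimately show ?thesis using that k by blast
qed

text \<open>Here \<open>mangoldt_series s = 1 / (s - 1) - f' / f\<close> with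
  \<open>f = pole_free_zeta\<close>. After multiplication by \<open>h\<close> at
  \<open>\<xi> + h\<close>, the first term contributes \<open>1\<close> exactly for
  \<open>\<xi> = 1\<close>, and the second contributes the order \<open>k\<close> of the zero at
  \<open>\<xi>\<close>.\<close>

lemma tendsto_mangoldt_series_at_right:
  assumes \<xi>: "Re \<xi> \<ge> 1"
  obtains k :: nat where "pole_free_zeta \<xi> = 0 \<longleftrightarrow> k > 0"
    "((\<lambda>h. of_real h * mangoldt_series (\<xi> + of_real h)) \<longlongrightarrow> (if \<xi> = 1 then 1 else 0) - of_nat k) (at_right 0)"
proof -
  have "connected {s. Re s > 0}" by (intro convex_connected convex_halfspace_Re_gt)
  then obtain k :: nat
    where k: "((\<lambda>w. (w - \<xi>) * (deriv pole_free_zeta w / pole_free_zeta w)) \<longlongrightarrow> of_nat k) (at \<xi>)"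
      "pole_free_zeta \<xi> = 0 \<longleftrightarrow> k > 0" "\<forall>\<^sub>F w in at \<xi>. pole_free_zeta w \<noteq> 0"
    using tendsto_log_deriv_order[OF holomorphic_pole_free_zeta open_halfspace_Re_gt _ _ , of \<xi> 1]
      \<xi> pole_free_zeta_1 by auto
  have lim: "filterlim (\<lambda>h. \<xi> + complex_of_real h) (at \<xi>) (at_right 0)"
    unfolding filterlim_at
    by (auto intro!: tendsto_eq_intros eventually_at_right_less simp: eventually_at_filter)
  have "((\<lambda>h. of_real h / (\<xi> - 1 + of_real h) - (\<xi> + of_real h - \<xi>) *
      (deriv pole_free_zeta (\<xi> + of_real h) / pole_free_zeta (\<xi> + of_real h))) \<longlongrightarrow>
      (if \<xi> = 1 then 1 else 0) - of_nat k) (at_right 0)"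
  proof (intro tendsto_diff filterlim_compose[OF k(1) lim])
    show "((\<lambda>h. complex_of_real h / (\<xi> - 1 + of_real h)) \<longlongrightarrow> (if \<xi> = 1 then 1 else 0)) (at_right 0)"
    proof (cases "\<xi> = 1")
      case True
      have "((\<lambda>h::real. 1 :: complex) \<longlongrightarrow> 1) (at_right 0)" by simp
      then have "((\<lambda>h. complex_of_real h / (\<xi> - 1 + of_real h)) \<longlongrightarrow> 1) (at_right 0)"
        by (rule Lim_transform_eventually)
          (use True in \<open>auto simp: eventually_at_filter\<close>)
      then show ?thesis using True by simp
    next
      case False
      have "((\<lambda>h. complex_of_real h / (\<xi> - 1 + of_real h)) \<longlongrightarrow> of_real 0 / (\<xi> - 1 + of_real 0)) (at_right 0)"
        using False by (intro tendsto_intros) auto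
      then show ?thesis using False by simp
    qed
  qed
  moreover have "\<forall>\<^sub>F h in at_right 0. of_real h / (\<xi> - 1 + of_real h) - (\<xi> + of_real h - \<xi>) *
      (deriv pole_free_zeta (\<xi> + of_real h) / pole_free_zeta (\<xi> + of_real h))
      = of_real h * mangoldt_series (\<xi> + of_real h)"
    using eventually_at_right_less[of 0] eventually_compose_filterlim[OF k(3) lim]
  proof eventually_elim
    case (elim h)
    then have "Re (\<xi> + of_real h) > 1" using \<xi> by simp
    from log_deriv_pole_free_zeta[OF this elim(2)] show ?case
      by (simp add: right_diff_distrib diff_add_eq)
  qed
  ultimately show ?thesis by (rule that[OF k(2) Lim_transform_eventually])
qed

lemma mangoldt_times_powr_Re:
  "Re (mangoldt n * of_nat n powr - Complex \<sigma> t) = mangoldt n * real n powr (-\<sigma>) * cos (t * ln (real n))"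
proof (cases "n = 0")
  case False
  have "of_nat n powr - Complex \<sigma> t = exp (- Complex \<sigma> t * of_real (ln (real n)))"
    using False by (simp add: powr_def)
  also have "- Complex \<sigma> t * of_real (ln (real n)) = Complex (-\<sigma> * ln (real n)) (- t * ln (real n))"
    by (simp add: complex_eq_iff)
  finally have "of_nat n powr - Complex \<sigma> t = exp (Complex (-\<sigma> * ln (real n)) (- t * ln (real n)))" .
  then have "Re (of_nat n powr - Complex \<sigma> t) = real n powr (-\<sigma>) * cos (t * ln (real n))"
    using False by (simp add: Re_exp powr_def)
  then show ?thesis by simp
qed auto

lemma sums_mangoldt_series_Re:
  assumes "\<sigma> > 1"
  shows "(\<lambda>n. mangoldt n * real n powr (-\<sigma>) * cos (t * ln (real n))) sums Re (mangoldt_series (Complex \<sigma> t))"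
  using sums_Re[OF has_sum_imp_sums[OF has_sum_mangoldt_series[of "Complex \<sigma> t"]]] assms
  by (simp only: mangoldt_times_powr_Re complex.sel)

text \<open>The inequality \<open>3 + 4 cos x + cos (2 x) = 2 (1 + cos x)\<^sup>2 \<ge> 0\<close>.\<close>

lemma mangoldt_series_341:
  assumes "\<sigma> > 1"
  shows "3 * Re (mangoldt_series (Complex \<sigma> 0)) + 4 * Re (mangoldt_series (Complex \<sigma> t))
           + Re (mangoldt_series (Complex \<sigma> (2 * t))) \<ge> 0"
proof -
  let ?f = "\<lambda>t n. mangoldt n * real n powr (-\<sigma>) * cos (t * ln (real n))"
  have sm: "(\<lambda>n. 3 * ?f 0 n + 4 * ?f t n + ?f (2 * t) n) sums
      (3 * Re (mangoldt_series (Complex \<sigma> 0)) + 4 * Re (mangoldt_series (Complex \<sigma> t))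
           + Re (mangoldt_series (Complex \<sigma> (2 * t))))"
    by (intro sums_add sums_mult sums_mangoldt_series_Re assms)
  have nn: "0 \<le> 3 * ?f 0 n + 4 * ?f t n + ?f (2 * t) n" for n
  proof -
    have "3 * ?f 0 n + 4 * ?f t n + ?f (2 * t) n = mangoldt n * real n powr (-\<sigma>) *
        (3 + 4 * cos (t * ln (real n)) + cos (2 * (t * ln (real n))))"
      by (simp add: algebra_simps)
    also have "3 + 4 * cos (t * ln (real n)) + cos (2 * (t * ln (real n)))
        = 2 * (1 + cos (t * ln (real n)))\<^sup>2"
      unfolding cos_double_cos by (simp add: algebra_simps power2_eq_square)
    finally have "3 * ?f 0 n + 4 * ?f t n + ?f (2 * t) n
        = mangoldt n * real n powr (-\<sigma>) * (2 * (1 + cos (t * ln (real n)))\<^sup>2)" .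
    then show ?thesis by (simp add: mangoldt_nonneg)
  qed
  show ?thesis by (rule sums_le[OF nn sums_zero sm])
qed

lemma norm_mangoldt_series_le:
  assumes "\<sigma> > 1" "Re s \<ge> \<sigma>"
  shows "norm (mangoldt_series s) \<le> (\<Sum>n. (ln (real n) + 1) * real n powr (-\<sigma>))"
  unfolding mangoldt_series_def
proof (rule norm_suminf_le[OF _ summable_ln_powr[OF assms(1)]])
  fix n
  show "norm (mangoldt n * of_nat n powr (-s) :: complex) \<le> (ln (real n) + 1) * real n powr (-\<sigma>)"
  proof (cases "n = 0")
    case False
    then show ?thesis
      using mangoldt_le_ln[of n] assms mangoldt_nonneg[of n]
      by (auto simp: norm_mult norm_of_nat_powr intro!: mult_mono powr_mono)
  qed auto
qed

text \<open>For \<open>Re s > 1\<close> the series stays bounded as \<open>h\<close> tends to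
  \<open>0\<close>, which forces order \<open>0\<close>. For \<open>s = 1 + i t\<close> with
  \<open>t \<noteq> 0\<close>, the 3-4-1 inequality is multiplied by \<open>h\<close> and passed to
  the limit at \<open>1\<close>, \<open>1 + i t\<close> and \<open>1 + 2 i t\<close>.\<close>

lemma pole_free_zeta_nonzero:
  assumes s: "Re s \<ge> 1"
  shows "pole_free_zeta s \<noteq> 0"
proof (cases "Re s > 1 \<or> s = 1")
  case True
  show ?thesis
  proof (cases "s = 1")
    case False
    then have s1: "Re s > 1" using True by auto
    obtain k :: nat where k: "pole_free_zeta s = 0 \<longleftrightarrow> k > 0"
      "((\<lambda>h. of_real h * mangoldt_series (s + of_real h)) \<longlongrightarrow> 0 - of_nat k) (at_right 0)"
      by (rule tendsto_mangoldt_series_at_right[OF s]) (unfold if_not_P[OF False], rule that)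
    define M where "M = (\<Sum>n. (ln (real n) + 1) * real n powr (- Re s))"
    have "((\<lambda>h. of_real h * mangoldt_series (s + of_real h)) \<longlongrightarrow> 0) (at_right 0)"
    proof (rule Lim_null_comparison)
      show "\<forall>\<^sub>F h in at_right 0. norm (of_real h * mangoldt_series (s + of_real h)) \<le> h * M"
        using eventually_at_right_less[of 0]
      proof eventually_elim
        case (elim h)
        then show ?case
          using norm_mangoldt_series_le[OF s1, of "s + of_real h"]
          by (auto simp: norm_mult M_def intro!: mult_left_mono)
      qed
      show "((\<lambda>h. h * M) \<longlongrightarrow> 0) (at_right 0)"
        by (auto intro!: tendsto_eq_intros)
    qed
    then have "of_nat k = (0 :: complex)"
      using tendsto_unique[OF _ k(2)] by force
    then show ?thesis using k(1) by simp
  qed (simp add: pole_free_zeta_1)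
next
  case False
  define t where "t = Im s"
  have s1: "s \<noteq> 1" using False by simp
  have st: "s = Complex 1 t" "t \<noteq> 0" using False s by (auto simp: t_def complex_eq_iff)
  obtain k1 where k1: "pole_free_zeta 1 = 0 \<longleftrightarrow> k1 > (0 :: nat)"
    "((\<lambda>h. of_real h * mangoldt_series (1 + of_real h)) \<longlongrightarrow> 1 - of_nat k1) (at_right 0)"
    by (rule tendsto_mangoldt_series_at_right[of 1]) (simp, unfold if_P[OF refl], rule that)
  have k1_0: "k1 = 0" using k1 pole_free_zeta_1 by simp
  obtain k where k: "pole_free_zeta s = 0 \<longleftrightarrow> k > (0 :: nat)"
    "((\<lambda>h. of_real h * mangoldt_series (s + of_real h)) \<longlongrightarrow> 0 - of_nat k) (at_right 0)"
    by (rule tendsto_mangoldt_series_at_right[OF s]) (unfold if_not_P[OF s1], rule that)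
  have t2: "Complex 1 (2 * t) \<noteq> 1" using st by (simp add: complex_eq_iff)
  obtain k2 :: nat where k2:
    "((\<lambda>h. of_real h * mangoldt_series (Complex 1 (2 * t) + of_real h)) \<longlongrightarrow> 0 - of_nat k2) (at_right 0)"
    by (rule tendsto_mangoldt_series_at_right[of "Complex 1 (2 * t)"])
      (simp, unfold if_not_P[OF t2], rule that)
  have "((\<lambda>h. 3 * Re (of_real h * mangoldt_series (1 + of_real h))
      + 4 * Re (of_real h * mangoldt_series (s + of_real h))
      + Re (of_real h * mangoldt_series (Complex 1 (2 * t) + of_real h))) \<longlongrightarrow>
      3 * Re (1 - of_nat k1) + 4 * Re (0 - of_nat k) + Re (0 - of_nat k2)) (at_right 0)"
    by (intro tendsto_intros k1(2) k(2) k2)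
  moreover have "\<forall>\<^sub>F h in at_right 0. 0 \<le> 3 * Re (of_real h * mangoldt_series (1 + of_real h))
      + 4 * Re (of_real h * mangoldt_series (s + of_real h))
      + Re (of_real h * mangoldt_series (Complex 1 (2 * t) + of_real h))"
    using eventually_at_right_less[of 0]
  proof eventually_elim
    case (elim h)
    have "1 + of_real h = Complex (1 + h) 0" "s + of_real h = Complex (1 + h) t"
      "Complex 1 (2 * t) + of_real h = Complex (1 + h) (2 * t)"
      using st by (auto simp: complex_eq_iff)
    moreover have "0 \<le> h * (3 * Re (mangoldt_series (Complex (1 + h) 0))
        + 4 * Re (mangoldt_series (Complex (1 + h) t)) + Re (mangoldt_series (Complex (1 + h) (2 * t))))"
      using elim by (intro mult_nonneg_nonneg mangoldt_series_341) auto
    ultimately show ?case by (simp add: algebra_simps)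
  qed
  ultimately have "0 \<le> 3 * Re (1 - of_nat k1) + 4 * Re (0 - of_nat k) + Re (0 - of_nat k2)"
    by (intro tendsto_lowerbound) auto
  \<comment> \<open>With \<open>k1 = 0\<close> the inequality reads
    \<open>3 - 4 * k - k2 \<ge> 0\<close>.\<close>
  then have "k = 0" by (simp add: k1_0)
  then show ?thesis using k(1) by simp
qed

text \<open>With \<open>B = pole_free_zeta\<close>, the series is
  \<open>(1 / (s - 1) - B' / B) - B / (s - 1)\<close>. As \<open>B 1 = 1\<close>, the poles at
  \<open>1\<close> cancel and leave the difference quotient \<open>?Q\<close>; non-vanishing keeps
  \<open>B' / B\<close> continuous up to the line.\<close>

lemma continuous_extension_mangoldt_minus_one_series:
  obtains E where "continuous_on {s. Re s \<ge> 1} E"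
    "\<And>s. Re s > 1 \<Longrightarrow> (\<lambda>n. (mangoldt n - 1) * of_nat n powr (-s)) sums E s"
proof
  let ?B = pole_free_zeta
  let ?Q = "\<lambda>z. if z = 1 then deriv ?B 1 else (?B z - ?B 1) / (z - 1)"
  define E where "E z = - ?Q z - deriv ?B z / ?B z" for z
  have sub: "{s. Re s \<ge> 1} \<subseteq> {s. Re s > 0}" by auto
  have "?Q holomorphic_on {s. Re s > 0}" "deriv ?B holomorphic_on {s. Re s > 0}"
    by (intro pole_lemma_open holomorphic_deriv holomorphic_pole_free_zeta open_halfspace_Re_gt)+
  then have "continuous_on {s. Re s \<ge> 1} ?Q" "continuous_on {s. Re s \<ge> 1} (deriv ?B)"
    "continuous_on {s. Re s \<ge> 1} ?B"
    using holomorphic_pole_free_zeta sub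
    by (meson holomorphic_on_imp_continuous_on holomorphic_on_subset)+
  then show "continuous_on {s. Re s \<ge> 1} E"
    unfolding E_def by (intro continuous_intros) (auto simp: pole_free_zeta_nonzero)
  show "(\<lambda>n. (mangoldt n - 1) * of_nat n powr (-s)) sums E s" if s: "Re s > 1" for s
  proof -
    have "s \<noteq> 1" using s by auto
    moreover have "((s - 1) * zeta_series s - 1) / (s - 1) = zeta_series s - 1 / (s - 1)"
      using \<open>s \<noteq> 1\<close> by (simp add: field_simps)
    ultimately have "E s = mangoldt_series s - zeta_series s"
      using log_deriv_pole_free_zeta[OF s] pole_free_zeta_nonzero[of s] s
      unfolding E_def by (simp add: pole_free_zeta_1 flip: pole_free_zeta_eq[OF s])
    moreover have "(\<lambda>n. mangoldt n * of_nat n powr (-s) - of_nat n powr (-s)) sums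
        (mangoldt_series s - zeta_series s)"
      by (intro sums_diff has_sum_imp_sums has_sum_mangoldt_series has_sum_zeta_series s)
    ultimately show ?thesis by (simp add: left_diff_distrib)
  qed
qed

section \<open>Prime powers in short intervals\<close>

text \<open>
  Shifting the variable by half a period \<open>\<pi> / u\<close> changes the sign of \<open>exp (\<i> t u)\<close>, so the integral
  is controlled by the modulus of continuity of \<open>\<phi>\<close>.
\<close>

lemma Riemann_Lebesgue_continuous:
  fixes \<phi> :: "real \<Rightarrow> complex"
  assumes cont: "continuous_on {0..R} \<phi>" and R: "R > 0"
  shows "((\<lambda>u. integral {0..R} (\<lambda>t. cis (t * u) * \<phi> t)) \<longlongrightarrow> 0) at_top"
proof (rule tendstoI)
  fix e :: real assume e: "e > 0"
  \<comment> \<open>\<open>\<psi>\<close> extends \<open>\<phi>\<close> by constants beyond the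
    interval, so that it can be shifted while its modulus of continuity stays the same.\<close>
  define \<psi> where "\<psi> t = \<phi> (max 0 (min R t))" for t
  have cont\<psi>: "continuous_on S \<psi>" for S
    unfolding \<psi>_def using R
    by (intro continuous_on_compose2[OF cont] continuous_intros) auto
  have "bounded (\<phi> ` {0..R})"
    using compact_continuous_image[OF cont] compact_imp_bounded by auto
  then obtain M where M: "\<And>t. t \<in> {0..R} \<Longrightarrow> norm (\<phi> t) \<le> M" and M0: "M > 0"
    unfolding bounded_pos by fastforce
  have M\<psi>: "norm (\<psi> t) \<le> M" for t unfolding \<psi>_def using R by (intro M) auto
  have "uniformly_continuous_on {0..R} \<phi>"
    using cont compact_uniformly_continuous by blast
  then obtain d where d: "d > 0"
    "\<And>s t. s \<in> {0..R} \<Longrightarrow> t \<in> {0..R} \<Longrightarrow> dist s t < d \<Longrightarrow> dist (\<phi> s) (\<phi> t) < e / (2 * R)"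
    unfolding uniformly_continuous_on_def using e R by (metis divide_pos_pos mult_pos_pos zero_less_numeral)
  define h where "h u = pi / u" for u :: real
  have h: "(h \<longlongrightarrow> 0) at_top" unfolding h_def by real_asymp
  have d': "min d (e / (8 * M)) > 0" using d e M0 by simp
  have "\<forall>\<^sub>F u in at_top. h u < min d (e / (8 * M))"
    by (rule order_tendstoD(2)[OF h d'])
  then show "\<forall>\<^sub>F u in at_top. dist (integral {0..R} (\<lambda>t. cis (t * u) * \<phi> t)) 0 < e"
    using eventually_gt_at_top[of 0]
  proof eventually_elim
    case (elim u)
    define hh where "hh = h u"
    have hh: "hh > 0" "hh < d" "hh < e / (8 * M)" "hh * u = pi"
      using elim by (auto simp: hh_def h_def)
    define F where "F t = cis (t * u) * \<psi> (t - hh)" for t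
    have contF: "continuous_on S F" for S
      unfolding F_def by (intro continuous_intros continuous_on_compose2[OF cont\<psi>]) auto
    have cont1: "continuous_on S (\<lambda>t. cis (t * u) * \<psi> t)" for S
      by (intro continuous_intros cont\<psi>)
    define I where "I = integral {0..R} (\<lambda>t. cis (t * u) * \<psi> t)"
    have eqI: "integral {0..R} (\<lambda>t. cis (t * u) * \<phi> t) = I"
      unfolding I_def by (intro integral_cong) (auto simp: \<psi>_def)
    have tri: "norm (a + b - c) \<le> norm a + norm b + norm c" for a b c :: complex
      using norm_triangle_ineq4[of "a + b" c] norm_triangle_ineq[of a b] by linarith
    have "F \<circ> (+) hh = (\<lambda>t. - (cis (t * u) * \<psi> t))"
    proof
      fix t
      have "cis ((hh + t) * u) = - cis (t * u)"
        using hh by (simp add: algebra_simps complex_eq_iff)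
      then show "(F \<circ> (+) hh) t = - (cis (t * u) * \<psi> t)" by (simp add: F_def)
    qed
    then have "integral {0+hh..R+hh} F = - I"
      using integral_shift_Icc_real[of 0 R F hh] by (simp add: I_def)
    moreover have "integral {0..hh} F + integral {hh..R+hh} F = integral {0..R+hh} F"
      "integral {0..R} F + integral {R..R+hh} F = integral {0..R+hh} F"
      using hh R by (intro Henstock_Kurzweil_Integration.integral_combine integrable_continuous_interval contF; simp)+
    \<comment> \<open>\<open>- I\<close> is the integral of \<open>F\<close> over
      \<open>[hh, R + hh]\<close>; comparing this interval with \<open>[0, R]\<close> leaves two end
      pieces of length \<open>hh\<close>.\<close>
    ultimately have "2 * I = (I - integral {0..R} F) + integral {0..hh} F - integral {R..R+hh} F"
      by (simp add: algebra_simps)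
    also have "I - integral {0..R} F = integral {0..R} (\<lambda>t. cis (t * u) * (\<psi> t - \<psi> (t - hh)))"
    proof -
      have "I - integral {0..R} F = integral {0..R} (\<lambda>t. cis (t * u) * \<psi> t - F t)"
        unfolding I_def by (intro Henstock_Kurzweil_Integration.integral_diff[symmetric]
          integrable_continuous_interval cont1 contF)
      then show ?thesis by (simp add: F_def right_diff_distrib)
    qed
    finally have "norm (2 * I) \<le> norm (integral {0..R} (\<lambda>t. cis (t * u) * (\<psi> t - \<psi> (t - hh))))
        + norm (integral {0..hh} F) + norm (integral {R..R+hh} F)"
      using tri by simp
    also have "norm (integral {0..R} (\<lambda>t. cis (t * u) * (\<psi> t - \<psi> (t - hh)))) \<le> e / (2 * R) * (R - 0)"
    proof (rule integral_bound)
      show "continuous_on {0..R} (\<lambda>t. cis (t * u) * (\<psi> t - \<psi> (t - hh)))"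
        by (intro continuous_intros cont\<psi> continuous_on_compose2[OF cont\<psi>]) auto
      fix t assume "t \<in> {0..R}"
      then have "dist (\<psi> t) (\<psi> (t - hh)) < e / (2 * R)"
        unfolding \<psi>_def using hh by (intro d) (auto simp: dist_real_def)
      then show "norm (cis (t * u) * (\<psi> t - \<psi> (t - hh))) \<le> e / (2 * R)"
        by (simp add: norm_mult dist_norm)
    qed (use R in auto)
    also have "norm (integral {0..hh} F) \<le> M * (hh - 0)"
      using hh M\<psi> by (intro integral_bound contF) (auto simp: F_def norm_mult)
    also have "norm (integral {R..R+hh} F) \<le> M * (R + hh - R)"
      using hh M\<psi> by (intro integral_bound contF) (auto simp: F_def norm_mult)
    also have "e / (2 * R) * (R - 0) + M * (hh - 0) + M * (R + hh - R) = e / 2 + 2 * M * hh"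
      using R by (simp add: field_simps)
    also have "2 * M * hh < e"
      using hh(3) M0 e by (simp add: field_simps)
    finally have "norm I < e" using e by (simp add: norm_mult)
    then show ?case by (simp add: eqI)
  qed
qed

section \<open>The Fejer kernel\<close>

definition fejer :: "real \<Rightarrow> real \<Rightarrow> real" where
  "fejer R v = integral {0..R} (\<lambda>t. (1 - t / R) * cos (t * v))"

lemma has_integral_fejer:
  "R > 0 \<Longrightarrow> ((\<lambda>t. (1 - t / R) * cos (t * v)) has_integral fejer R v) {0..R}"
  unfolding fejer_def
  by (intro integrable_integral integrable_continuous_interval continuous_intros) auto

text \<open>The integral is half the Fourier transform of the triangle on \<open>[-R, R]\<close>,
  that is, an unnormalised Fejer kernel. \<open>F\<close> arises from integration by parts. Sign and
  quadratic decay can be read off the closed form.\<close>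

lemma fejer_eq:
  assumes R: "R > 0" and v: "v \<noteq> 0"
  shows "fejer R v = (1 - cos (R * v)) / (R * v\<^sup>2)"
proof -
  define F where "F t = (1 - t / R) * sin (t * v) / v - cos (t * v) / (R * v\<^sup>2)" for t
  have "((\<lambda>t. (1 - t / R) * cos (t * v)) has_integral F R - F 0) {0..R}"
  proof (rule fundamental_theorem_of_calculus)
    show "(F has_vector_derivative (1 - t / R) * cos (t * v)) (at t within {0..R})" for t
      unfolding F_def has_real_derivative_iff_has_vector_derivative[symmetric]
      using R v by (auto intro!: derivative_eq_intros simp: field_simps power2_eq_square)
  qed (use R in auto)
  then have "fejer R v = F R - F 0"
    using has_integral_fejer[OF R] has_integral_unique by blast
  then show ?thesis using R v by (simp add: F_def diff_divide_distrib)
qed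

lemma fejer_le:
  assumes R: "R > 0"
  shows "fejer R v \<le> R"
proof -
  have "fejer R v \<le> 1 * (R - 0)"
  proof (rule has_integral_le[OF has_integral_fejer[OF R]])
    show "((\<lambda>_. 1) has_integral 1 * (R - 0)) {0..R}"
      using has_integral_const_real[of "1::real" 0 R] R by simp
    fix t assume "t \<in> {0..R}"
    then have w: "0 \<le> 1 - t / R" "1 - t / R \<le> 1" using R by (auto simp: field_simps)
    have "(1 - t / R) * cos (t * v) \<le> (1 - t / R) * 1" using w by (intro mult_left_mono) auto
    then show "(1 - t / R) * cos (t * v) \<le> 1" using w by simp
  qed
  then show ?thesis by simp
qed

text \<open>For such \<open>v\<close> the angle \<open>t * v\<close> stays in
  \<open>[-1, 1]\<close>, where the cosine is at least \<open>1 / 2\<close>; half the area of the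
  triangle on \<open>[0, R]\<close> is \<open>R / 4\<close>.\<close>

lemma fejer_ge:
  assumes R: "R > 0" and v: "\<bar>v\<bar> \<le> 1 / R"
  shows "fejer R v \<ge> R / 4"
proof (rule has_integral_le[OF _ has_integral_fejer[OF R]])
  define F where "F t = t / 2 - t\<^sup>2 / (4 * R)" for t
  have "((\<lambda>t. (1 - t / R) * (1 / 2)) has_integral F R - F 0) {0..R}"
  proof (rule fundamental_theorem_of_calculus)
    show "(F has_vector_derivative (1 - t / R) * (1 / 2)) (at t within {0..R})" for t
      unfolding F_def has_real_derivative_iff_has_vector_derivative[symmetric]
      using R by (auto intro!: derivative_eq_intros simp: field_simps)
  qed (use R in auto)
  moreover have "F R - F 0 = R / 4" using R by (simp add: F_def field_simps power2_eq_square)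
  ultimately show "((\<lambda>t. (1 - t / R) * (1 / 2)) has_integral R / 4) {0..R}" by simp
  fix t assume t: "t \<in> {0..R}"
  have "\<bar>t * v\<bar> \<le> R * (1 / R)" unfolding abs_mult using t v R by (intro mult_mono) auto
  then have tv: "\<bar>t * v\<bar> \<le> pi / 3" using R pi_gt3 by simp
  have "1 / 2 = cos (pi / 3)" by (simp add: cos_60)
  also have "\<dots> \<le> cos \<bar>t * v\<bar>" using tv by (intro cos_monotone_0_pi_le) auto
  finally have "1 / 2 \<le> cos (t * v)" by simp
  then show "(1 - t / R) * (1 / 2) \<le> (1 - t / R) * cos (t * v)"
    using t R by (intro mult_left_mono) auto
qed

lemma fejer_nonneg:
  assumes "R > 0"
  shows "fejer R v \<ge> 0"
  using fejer_ge[of R 0] assms by (cases "v = 0") (auto simp: fejer_eq)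

text \<open>The shape \<open>1 / (1 + v\<^sup>2)\<close> is summable over unit windows, and the
  factor \<open>1 / R\<close> makes the tail outside \<open>[-\<epsilon>, \<epsilon>]\<close> small.
  It is reached from \<open>2 / (R * v\<^sup>2)\<close> by
  \<open>\<epsilon>\<^sup>2 * (1 + v\<^sup>2) \<le> 2 * v\<^sup>2\<close>.\<close>

lemma fejer_decay:
  assumes R: "R > 0" and \<epsilon>: "0 < \<epsilon>" "\<epsilon> \<le> 1" and v: "\<bar>v\<bar> \<ge> \<epsilon>"
  shows "fejer R v \<le> 4 / (R * \<epsilon>\<^sup>2) * (1 / (1 + v\<^sup>2))"
proof -
  have v0: "v \<noteq> 0" "v\<^sup>2 > 0" using \<epsilon> v by auto
  have e2: "\<epsilon>\<^sup>2 \<le> 1" using \<epsilon> by (simp add: power_le_one)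
  have "\<epsilon>\<^sup>2 \<le> v\<^sup>2" using \<epsilon> v by (metis abs_le_square_iff abs_of_pos)
  moreover have "\<epsilon>\<^sup>2 * v\<^sup>2 \<le> 1 * v\<^sup>2" using e2 by (intro mult_right_mono) auto
  ultimately have *: "\<epsilon>\<^sup>2 * (1 + v\<^sup>2) \<le> 2 * v\<^sup>2" by (simp add: algebra_simps)
  have "fejer R v \<le> 2 / (R * v\<^sup>2)"
    unfolding fejer_eq[OF R v0(1)] using R v0 cos_ge_minus_one[of "R * v"]
    by (intro divide_right_mono) auto
  also have "\<dots> = 4 / (R * (2 * v\<^sup>2))" by simp
  also have "\<dots> \<le> 4 / (R * (\<epsilon>\<^sup>2 * (1 + v\<^sup>2)))"
    using R v0 \<epsilon> * by (intro divide_left_mono mult_left_mono mult_pos_pos) (auto simp: add_pos_nonneg)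
  also have "\<dots> = 4 / (R * \<epsilon>\<^sup>2) * (1 / (1 + v\<^sup>2))" by (simp add: mult.assoc)
  finally show ?thesis .
qed

section \<open>Fejer means of \<open>mangoldt n - 1\<close>\<close>

lemma summable_fejer_mean:
  assumes c: "\<And>n. \<bar>c n\<bar> \<le> ln (real n) + 1" and \<sigma>: "\<sigma> > 1" and R: "R > 0"
  shows "summable (\<lambda>n. c n * real n powr (-\<sigma>) * fejer R (u - ln (real n)))"
proof (rule summable_comparison_test'[OF summable_mult[OF summable_ln_powr[OF \<sigma>], of R], of 0])
  fix n :: nat
  have "\<bar>c n\<bar> * (real n powr (-\<sigma>) * fejer R (u - ln (real n)))
      \<le> (ln (real n) + 1) * (real n powr (-\<sigma>) * R)"
    using c fejer_le[OF R] fejer_nonneg[OF R] ln_of_nat_nonneg[of n] by (intro mult_mono) auto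
  then show "norm (c n * real n powr (-\<sigma>) * fejer R (u - ln (real n)))
      \<le> R * ((ln (real n) + 1) * real n powr (-\<sigma>))"
    using fejer_nonneg[OF R] by (simp add: abs_mult mult_ac)
qed

lemma abs_mangoldt_minus_one_le: "\<bar>mangoldt n - 1\<bar> \<le> ln (real n) + (1 :: real)"
  using mangoldt_le_ln[of n] mangoldt_nonneg[of n] ln_of_nat_nonneg[of n] by linarith

text \<open>For \<open>\<sigma> > 1\<close> the Dirichlet series converges uniformly in
  \<open>t\<close>, so sum and integral may be exchanged. The real part of
  \<open>cis (t * u) * n powr (- i t)\<close> is \<open>cos (t * (u - ln n))\<close>, which
  integrates to the kernel.\<close>

lemma fejer_mean_sums_integral:
  assumes cont: "continuous_on {s. Re s \<ge> 1} E"
    and E: "\<And>s. Re s > 1 \<Longrightarrow> (\<lambda>n. (mangoldt n - 1) * of_nat n powr (-s)) sums E s"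
    and \<sigma>: "\<sigma> > 1" and R: "R > 0"
  shows "(\<lambda>n. (mangoldt n - 1) * real n powr (-\<sigma>) * fejer R (u - ln (real n))) sums
           Re (integral {0..R} (\<lambda>t. cis (t * u) * (of_real (1 - t / R) * E (Complex \<sigma> t))))"
proof -
  define f where "f n t = cis (t * u) * (of_real (1 - t / R) * (of_real (mangoldt n - 1) * of_nat n powr (- Complex \<sigma> t)))"
    for n and t :: real
  have Re_f: "Re (f n t) = (mangoldt n - 1) * real n powr (-\<sigma>) * ((1 - t / R) * cos (t * (u - ln (real n))))" for n t
  proof (cases "n = 0")
    case False
    have "of_nat n powr - Complex \<sigma> t = exp (- Complex \<sigma> t * of_real (ln (real n)))"
      using False by (simp add: powr_def)
    also have "- Complex \<sigma> t * of_real (ln (real n)) = Complex (-\<sigma> * ln (real n)) (- t * ln (real n))"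
      by (simp add: complex_eq_iff)
    also have "exp \<dots> = of_real (real n powr (-\<sigma>)) * cis (- t * ln (real n))"
      using False by (simp add: exp_eq_polar powr_def)
    finally have "f n t = of_real ((1 - t / R) * (mangoldt n - 1) * real n powr (-\<sigma>)) *
        (cis (t * u) * cis (- t * ln (real n)))"
      by (simp add: f_def)
    also have "cis (t * u) * cis (- t * ln (real n)) = cis (t * (u - ln (real n)))"
      by (simp add: cis_mult algebra_simps)
    finally have "f n t = of_real ((1 - t / R) * (mangoldt n - 1) * real n powr (-\<sigma>)) *
        cis (t * (u - ln (real n)))" .
    moreover have "Re (of_real a * cis b) = a * cos b" for a b by simp
    ultimately show ?thesis by (simp only: mult_ac)
  qed (simp add: f_def)
  have contE: "continuous_on {0..R} (\<lambda>t. E (Complex \<sigma> t))"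
    using \<sigma> by (intro continuous_on_compose2[OF cont] continuous_intros) auto
  have cont_f: "continuous_on {0..R} (f n)" for n
  proof (cases "n = 0")
    case False
    then show ?thesis unfolding f_def using R by (intro continuous_intros) auto
  qed (simp add: f_def)
  have "uniform_limit {0..R} (\<lambda>N t. \<Sum>n<N. f n t) (\<lambda>t. \<Sum>n. f n t) sequentially"
  proof (rule Weierstrass_m_test[OF _ summable_ln_powr[OF \<sigma>]])
    fix n t assume "t \<in> {0..R}"
    then have "\<bar>1 - t / R\<bar> \<le> 1" using R by (auto simp: field_simps abs_le_iff)
    moreover have "norm (complex_of_real (mangoldt n - 1)) \<le> ln (real n) + 1"
      using abs_mangoldt_minus_one_le[of n] by (simp only: norm_of_real)
    moreover have "norm (f n t) = \<bar>1 - t / R\<bar> * (norm (complex_of_real (mangoldt n - 1)) * real n powr (-\<sigma>))"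
      by (simp only: f_def norm_mult norm_of_nat_powr norm_cis norm_of_real) simp
    ultimately show "norm (f n t) \<le> (ln (real n) + 1) * real n powr (-\<sigma>)"
      using mult_mono[of "\<bar>1 - t / R\<bar>" 1 "norm (complex_of_real (mangoldt n - 1)) * real n powr (-\<sigma>)"
          "(ln (real n) + 1) * real n powr (-\<sigma>)"]
      by (simp add: mult_right_mono)
  qed
  then obtain I J where IJ: "\<And>N. ((\<lambda>t. \<Sum>n<N. f n t) has_integral I N) {0..R}"
    "((\<lambda>t. \<Sum>n. f n t) has_integral J) {0..R}" "I \<longlonglongrightarrow> J"
    by (rule uniform_limit_integral) (auto intro!: continuous_on_sum cont_f)
  have "(\<Sum>n. f n t) = cis (t * u) * (of_real (1 - t / R) * E (Complex \<sigma> t))" for t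
    using sums_mult[OF E[of "Complex \<sigma> t"], of "cis (t * u) * of_real (1 - t / R)"] \<sigma>
    by (simp add: f_def sums_iff mult.assoc)
  then have J: "J = integral {0..R} (\<lambda>t. cis (t * u) * (of_real (1 - t / R) * E (Complex \<sigma> t)))"
    using IJ(2) by (simp add: integral_unique)
  have "Re (I N) = (\<Sum>n<N. (mangoldt n - 1) * real n powr (-\<sigma>) * fejer R (u - ln (real n)))" for N
  proof -
    have "((\<lambda>t. \<Sum>n<N. Re (f n t)) has_integral Re (I N)) {0..R}"
      using has_integral_linear[OF IJ(1) bounded_linear_Re] by (simp add: o_def)
    moreover have "((\<lambda>t. \<Sum>n<N. Re (f n t)) has_integral
        (\<Sum>n<N. (mangoldt n - 1) * real n powr (-\<sigma>) * fejer R (u - ln (real n)))) {0..R}"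
      unfolding Re_f by (intro has_integral_sum has_integral_mult_right has_integral_fejer R) auto
    ultimately show ?thesis by (rule has_integral_unique)
  qed
  then show ?thesis
    using tendsto_Re[OF IJ(3)] by (simp add: sums_def J)
qed

text \<open>Both parts use the continuity of \<open>E\<close> up to \<open>Re s = 1\<close>.
  Boundedness on the compact rectangle \<open>Q\<close> gives \<open>M\<close>. At
  \<open>\<sigma> = 1\<close> the integral is small for large \<open>u\<close> by Riemann-Lebesgue,
  and uniform continuity on \<open>Q\<close> carries this to nearby \<open>\<sigma>\<close>,
  uniformly in \<open>u\<close>.\<close>

lemma fejer_mean_mangoldt_minus_one:
  fixes R :: real
  assumes R: "R > 0"
  defines "S \<equiv> \<lambda>\<sigma> u. \<Sum>n. (mangoldt n - 1) * real n powr (-\<sigma>) * fejer R (u - ln (real n))"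
  shows "\<exists>M. \<forall>\<sigma> u. 1 < \<sigma> \<and> \<sigma> \<le> 2 \<longrightarrow> \<bar>S \<sigma> u\<bar> \<le> M" (is ?bounded)
    and "\<eta> > 0 \<Longrightarrow> \<exists>U \<delta>. \<delta> > 0 \<and> (\<forall>u\<ge>U. \<forall>\<sigma>. 1 < \<sigma> \<and> \<sigma> < 1 + \<delta> \<longrightarrow> \<bar>S \<sigma> u\<bar> \<le> \<eta>)"
      (is "_ \<Longrightarrow> ?small")
proof -
  obtain E where cont: "continuous_on {s. Re s \<ge> 1} E"
    and E: "\<And>s. Re s > 1 \<Longrightarrow> (\<lambda>n. (mangoldt n - 1) * of_nat n powr (-s)) sums E s"
    by (rule continuous_extension_mangoldt_minus_one_series) (rule that)
  define J where "J \<sigma> u = integral {0..R} (\<lambda>t. cis (t * u) * (of_real (1 - t / R) * E (Complex \<sigma> t)))" for \<sigma> u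
  have S: "S \<sigma> u = Re (J \<sigma> u)" if "\<sigma> > 1" for \<sigma> u
    unfolding S_def J_def by (rule sums_unique[symmetric, OF fejer_mean_sums_integral[OF cont E that R]])
  define Q where "Q = cbox (Complex 1 0) (Complex 2 R)"
  have Q: "Complex \<sigma> t \<in> Q" if "1 \<le> \<sigma>" "\<sigma> \<le> 2" "t \<in> {0..R}" for \<sigma> t
    using that by (auto simp: Q_def in_cbox_complex_iff)
  have contQ: "continuous_on Q E" and cQ: "compact Q"
    using continuous_on_subset[OF cont] by (auto simp: Q_def in_cbox_complex_iff subset_iff)
  have contE: "continuous_on {0..R} (\<lambda>t. E (Complex \<sigma> t))" if "\<sigma> \<ge> 1" for \<sigma>
    using that by (intro continuous_on_compose2[OF cont] continuous_intros) auto
  have w: "\<bar>1 - t / R\<bar> \<le> 1" if "t \<in> {0..R}" for t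
    using that R by (auto simp: field_simps abs_le_iff)
  have bound: "norm (integral {0..R} (\<lambda>t. cis (t * u) * (of_real (1 - t / R) * F t))) \<le> B * R"
    if F: "continuous_on {0..R} F" "\<And>t. t \<in> {0..R} \<Longrightarrow> norm (F t) \<le> B" for u B and F :: "real \<Rightarrow> complex"
  proof -
    have "norm (integral {0..R} (\<lambda>t. cis (t * u) * (of_real (1 - t / R) * F t))) \<le> B * (R - 0)"
    proof (rule integral_bound)
      show "continuous_on {0..R} (\<lambda>t. cis (t * u) * (of_real (1 - t / R) * F t))"
        using R by (intro continuous_intros F) auto
      show "norm (cis (t * u) * (of_real (1 - t / R) * F t)) \<le> B" if t: "t \<in> {0..R}" for t
        using mult_mono[OF w[OF t] F(2)[OF t]] by (simp only: norm_mult norm_cis norm_of_real) simp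
    qed (use R in auto)
    then show ?thesis by simp
  qed
  show ?bounded
  proof -
    have "bounded (E ` Q)"
      using compact_continuous_image[OF contQ cQ] compact_imp_bounded by blast
    then obtain B where B: "\<And>z. z \<in> Q \<Longrightarrow> norm (E z) \<le> B" unfolding bounded_iff by auto
    have "\<bar>S \<sigma> u\<bar> \<le> B * R" if "1 < \<sigma>" "\<sigma> \<le> 2" for \<sigma> u
      using bound[OF contE, of \<sigma> B u] B Q that abs_Re_le_cmod[of "J \<sigma> u"]
      by (force simp: S J_def)
    then show ?thesis by blast
  qed
  show ?small if \<eta>: "\<eta> > 0"
  proof -
    have "uniformly_continuous_on Q E"
      using contQ cQ compact_uniformly_continuous by blast
    moreover have "\<eta> / (2 * R) > 0" using \<eta> R by simp
    ultimately obtain d where d: "d > 0" "\<And>x y. x \<in> Q \<Longrightarrow> y \<in> Q \<Longrightarrow> dist x y < d \<Longrightarrow> dist (E x) (E y) < \<eta> / (2 * R)"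
      unfolding uniformly_continuous_on_def by metis
    have "((\<lambda>u. J 1 u) \<longlongrightarrow> 0) at_top"
      unfolding J_def using R
      by (intro Riemann_Lebesgue_continuous continuous_intros contE) auto
    then have "\<forall>\<^sub>F u in at_top. dist (J 1 u) 0 < \<eta> / 2"
      using \<eta> by (intro tendstoD) auto
    then obtain U where U: "\<And>u. u \<ge> U \<Longrightarrow> norm (J 1 u) < \<eta> / 2"
      by (auto simp: eventually_at_top_linorder)
    have "\<bar>S \<sigma> u\<bar> \<le> \<eta>" if u: "u \<ge> U" and \<sigma>: "1 < \<sigma>" "\<sigma> < 1 + min d 1" for u \<sigma>
    proof -
      have ib: "(\<lambda>t. cis (t * u) * (of_real (1 - t / R) * E (Complex \<sigma> t))) integrable_on {0..R}" if "\<sigma> \<ge> 1" for \<sigma>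
        using R that by (intro integrable_continuous_interval continuous_intros contE) auto
      have "J \<sigma> u - J 1 u =
          integral {0..R} (\<lambda>t. cis (t * u) * (of_real (1 - t / R) * (E (Complex \<sigma> t) - E (Complex 1 t))))"
        unfolding J_def using ib \<sigma>
        by (subst Henstock_Kurzweil_Integration.integral_diff[symmetric])
          (auto intro!: integral_cong simp: algebra_simps)
      also have "norm \<dots> \<le> \<eta> / (2 * R) * R"
      proof (rule bound)
        show "continuous_on {0..R} (\<lambda>t. E (Complex \<sigma> t) - E (Complex 1 t))"
          using \<sigma> by (intro continuous_intros contE) auto
        fix t assume t: "t \<in> {0..R}"
        have "dist (Complex \<sigma> t) (Complex 1 t) < d"
        proof -
          have "Complex \<sigma> t - Complex 1 t = of_real (\<sigma> - 1)" by (simp add: complex_eq_iff)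
          then have "dist (Complex \<sigma> t) (Complex 1 t) = \<bar>\<sigma> - 1\<bar>"
            by (simp only: dist_norm norm_of_real)
          then show ?thesis using \<sigma> by linarith
        qed
        moreover have "Complex \<sigma> t \<in> Q" "Complex 1 t \<in> Q" using \<sigma> t by (intro Q; simp)+
        ultimately show "norm (E (Complex \<sigma> t) - E (Complex 1 t)) \<le> \<eta> / (2 * R)"
          using d(2)[of "Complex \<sigma> t" "Complex 1 t"] by (simp add: dist_norm)
      qed
      also have "\<dots> = \<eta> / 2" using R by simp
      finally have "norm (J \<sigma> u) \<le> \<eta>"
        using U[OF u] norm_triangle_sub[of "J \<sigma> u" "J 1 u"] by linarith
      then show ?thesis using S[OF \<sigma>(1)] abs_Re_le_cmod[of "J \<sigma> u"] by simp
    qed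
    then show ?thesis using d(1) by (intro exI[of _ U] exI[of _ "min d 1"]) auto
  qed
qed

section \<open>Upper bounds over logarithmic windows\<close>

lemma summable_inverse_one_plus_square: "summable (\<lambda>k. 1 / (1 + (real k)\<^sup>2))"
proof (rule summable_comparison_test'[where N = 1])
  show "summable (\<lambda>k. real k powr (-2))" by (simp add: summable_real_powr_iff)
  fix k :: nat assume "k \<ge> 1"
  then have "real k powr (-2) = 1 / (real k)\<^sup>2"
    by (simp add: powr_minus divide_inverse)
  then show "norm (1 / (1 + (real k)\<^sup>2)) \<le> real k powr (-2)"
    using \<open>k \<ge> 1\<close> by (auto intro!: divide_left_mono mult_pos_pos add_pos_pos)
qed

text \<open>The \<open>n\<close> with \<open>\<lfloor>\<bar>u - ln n\<bar>\<rfloor> = k\<close> lie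
  in two unit windows, one on each side of \<open>u\<close>, where the weight is at most
  \<open>1 / (1 + k\<^sup>2)\<close>.\<close>

lemma sum_over_unit_windows_le:
  fixes a :: "nat \<Rightarrow> real"
  assumes a: "\<And>n. a n \<ge> 0"
    and win: "\<And>v F. finite F \<Longrightarrow> \<forall>n\<in>F. v \<le> ln (real n) \<and> ln (real n) \<le> v + 1 \<Longrightarrow> sum a F \<le> C"
    and F: "finite F"
  shows "(\<Sum>n\<in>F. a n * (1 / (1 + (u - ln (real n))\<^sup>2))) \<le> 2 * C * (\<Sum>k. 1 / (1 + (real k)\<^sup>2))"
proof -
  define \<kappa> where "\<kappa> n = nat \<lfloor>\<bar>u - ln (real n)\<bar>\<rfloor>" for n
  have C: "C \<ge> 0" using win[of "{}" 0] by simp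
  have \<kappa>: "real (\<kappa> n) \<le> \<bar>u - ln (real n)\<bar>" "\<bar>u - ln (real n)\<bar> \<le> real (\<kappa> n) + 1" for n
    unfolding \<kappa>_def by linarith+
  have "(\<Sum>n\<in>F. a n * (1 / (1 + (u - ln (real n))\<^sup>2)))
      = (\<Sum>k\<in>\<kappa> ` F. \<Sum>n\<in>{n\<in>F. \<kappa> n = k}. a n * (1 / (1 + (u - ln (real n))\<^sup>2)))"
    by (rule sum.image_gen[OF F])
  also have "\<dots> \<le> (\<Sum>k\<in>\<kappa> ` F. 2 * C * (1 / (1 + (real k)\<^sup>2)))"
  proof (rule sum_mono)
    fix k :: nat
    let ?A = "{n\<in>F. u + real k \<le> ln (real n) \<and> ln (real n) \<le> u + real k + 1}"
    let ?B = "{n\<in>F. u - real k - 1 \<le> ln (real n) \<and> ln (real n) \<le> u - real k - 1 + 1}"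
    have "(\<Sum>n\<in>{n\<in>F. \<kappa> n = k}. a n * (1 / (1 + (u - ln (real n))\<^sup>2)))
        \<le> (\<Sum>n\<in>{n\<in>F. \<kappa> n = k}. a n * (1 / (1 + (real k)\<^sup>2)))"
    proof (intro sum_mono mult_left_mono a divide_left_mono)
      fix n assume "n \<in> {n\<in>F. \<kappa> n = k}"
      then show "1 + (real k)\<^sup>2 \<le> 1 + (u - ln (real n))\<^sup>2"
        using \<kappa>(1)[of n] abs_le_square_iff[of "real k" "u - ln (real n)"] by simp
    qed (auto intro!: mult_pos_pos add_pos_nonneg)
    also have "\<dots> = (\<Sum>n\<in>{n\<in>F. \<kappa> n = k}. a n) * (1 / (1 + (real k)\<^sup>2))"
      by (rule sum_distrib_right[symmetric])
    also have "\<dots> \<le> 2 * C * (1 / (1 + (real k)\<^sup>2))"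
    proof (rule mult_right_mono)
      have "(\<Sum>n\<in>{n\<in>F. \<kappa> n = k}. a n) \<le> sum a (?A \<union> ?B)"
      proof (rule sum_mono2)
        show "{n\<in>F. \<kappa> n = k} \<subseteq> ?A \<union> ?B"
        proof
          fix n assume "n \<in> {n\<in>F. \<kappa> n = k}"
          then show "n \<in> ?A \<union> ?B" using \<kappa>[of n] by (auto simp: abs_if split: if_splits)
        qed
      qed (use F a in auto)
      also have "\<dots> \<le> sum a ?A + sum a ?B"
        using F a sum_nonneg[of "?A \<inter> ?B" a] by (subst sum_Un) auto
      also have "\<dots> \<le> C + C"
        using F by (intro add_mono win[of _ "u + real k"] win[of _ "u - real k - 1"]) auto
      finally show "(\<Sum>n\<in>{n\<in>F. \<kappa> n = k}. a n) \<le> 2 * C" by simp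
    qed simp
    finally show "(\<Sum>n\<in>{n\<in>F. \<kappa> n = k}. a n * (1 / (1 + (u - ln (real n))\<^sup>2)))
        \<le> 2 * C * (1 / (1 + (real k)\<^sup>2))" .
  qed
  also have "\<dots> = 2 * C * (\<Sum>k\<in>\<kappa> ` F. 1 / (1 + (real k)\<^sup>2))"
    by (rule sum_distrib_left[symmetric])
  also have "\<dots> \<le> 2 * C * (\<Sum>k. 1 / (1 + (real k)\<^sup>2))"
    using F C by (intro mult_left_mono sum_le_suminf summable_inverse_one_plus_square) auto
  finally show ?thesis .
qed

text \<open>At most \<open>exp (v + 1)\<close> positive integers have logarithm at most
  \<open>v + 1\<close>, and each contributes at most \<open>exp (- v)\<close>.\<close>

lemma sum_powr_window_le:
  assumes \<sigma>: "\<sigma> \<ge> 1" and F: "finite F"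
    and win: "\<forall>n\<in>F. v \<le> ln (real n) \<and> ln (real n) \<le> v + 1"
  shows "(\<Sum>n\<in>F. real n powr (-\<sigma>)) \<le> exp 1"
proof -
  \<comment> \<open>Since \<open>ln 0 = 0\<close>, the index \<open>0\<close> may belong to
    \<open>F\<close>; its term is \<open>0\<close>.\<close>
  have "(\<Sum>n\<in>F. real n powr (-\<sigma>)) = (\<Sum>n\<in>F-{0}. real n powr (-\<sigma>))"
    using F by (intro sum.mono_neutral_right) auto
  also have "\<dots> \<le> (\<Sum>n\<in>F-{0}. exp (- v))"
  proof (rule sum_mono)
    fix n assume n: "n \<in> F - {0}"
    then have "v \<le> ln (real n)" using win by auto
    then have "exp v \<le> real n" using n by (simp add: ln_ge_iff)
    then have "inverse (real n) \<le> inverse (exp v)" by (intro le_imp_inverse_le) auto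
    moreover have "real n powr (-\<sigma>) \<le> real n powr (-1)" using n \<sigma> by (intro powr_mono) auto
    ultimately show "real n powr (-\<sigma>) \<le> exp (- v)"
      using n by (simp add: powr_minus exp_minus)
  qed
  also have "\<dots> = real (card (F - {0})) * exp (- v)" by simp
  also have "\<dots> \<le> exp (v + 1) * exp (- v)"
  proof (rule mult_right_mono)
    have "F - {0} \<subseteq> {1..nat \<lfloor>exp (v + 1)\<rfloor>}"
    proof
      fix n assume n: "n \<in> F - {0}"
      then have "ln (real n) \<le> v + 1" using win by auto
      then have "exp (ln (real n)) \<le> exp (v + 1)" by (simp only: exp_le_cancel_iff)
      moreover have "exp (ln (real n)) = real n" using n by simp
      ultimately have "real n \<le> exp (v + 1)" by (simp only:)
      then show "n \<in> {1..nat \<lfloor>exp (v + 1)\<rfloor>}" using n by (auto simp: le_nat_floor)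
    qed
    then have "card (F - {0}) \<le> nat \<lfloor>exp (v + 1)\<rfloor>"
      using card_mono[of "{1..nat \<lfloor>exp (v + 1)\<rfloor>}"] by simp
    then show "real (card (F - {0})) \<le> exp (v + 1)"
      by (meson exp_ge_zero le_nat_floor of_nat_floor of_nat_mono order_trans)
  qed simp
  also have "\<dots> = exp 1" by (simp flip: exp_add)
  finally show ?thesis .
qed

lemma suminf_le_of_finite_sums:
  fixes f :: "nat \<Rightarrow> real"
  assumes "summable f" "\<And>F. finite F \<Longrightarrow> sum f F \<le> C"
  shows "suminf f \<le> C"
  using assms by (intro suminf_le_const) auto

lemma fejer_mean_one_le:
  assumes R: "R > 0"
  shows "\<exists>C. \<forall>\<sigma> u. \<sigma> > 1 \<longrightarrow> (\<Sum>n. real n powr (-\<sigma>) * fejer R (u - ln (real n))) \<le> C"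
proof -
  \<comment> \<open>\<open>A\<close> dominates both the trivial bound \<open>R\<close>, used for
    \<open>\<bar>v\<bar> < 1\<close>, and the decay constant \<open>4 / R\<close>; the factor
    \<open>2\<close> pays for \<open>1 / (1 + v\<^sup>2) \<ge> 1 / 2\<close> near
    \<open>0\<close>.\<close>
  define A where "A = R + 4 / R"
  have le: "fejer R v \<le> 2 * A * (1 / (1 + v\<^sup>2))" for v
  proof (cases "\<bar>v\<bar> \<ge> 1")
    case True
    have "fejer R v \<le> 4 / (R * 1\<^sup>2) * (1 / (1 + v\<^sup>2))"
      by (rule fejer_decay[OF R _ _ True]) auto
    also have "\<dots> \<le> 2 * A * (1 / (1 + v\<^sup>2))"
    proof (rule mult_right_mono)
      define p where "p = 4 / R"
      have "p > 0" "A = R + p" using R by (simp_all add: p_def A_def)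
      then have "p \<le> 2 * A" using R by linarith
      then show "4 / (R * 1\<^sup>2) \<le> 2 * A" by (simp add: p_def)
    qed simp
    finally show ?thesis .
  next
    case False
    then have "v\<^sup>2 \<le> 1" by (simp add: abs_square_le_1)
    then have "1 / 2 \<le> 1 / (1 + v\<^sup>2)" by (intro divide_left_mono) (auto intro!: mult_pos_pos add_pos_nonneg)
    then have "2 * A * (1 / 2) \<le> 2 * A * (1 / (1 + v\<^sup>2))"
      using R by (intro mult_left_mono) (auto simp: A_def)
    moreover have "R \<le> A" using R by (simp add: A_def)
    ultimately show ?thesis using fejer_le[OF R, of v] by linarith
  qed
  let ?T = "\<Sum>k. 1 / (1 + (real k)\<^sup>2)"
  have "(\<Sum>n. real n powr (-\<sigma>) * fejer R (u - ln (real n))) \<le> 2 * A * (2 * exp 1 * ?T)"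
    if \<sigma>: "\<sigma> > 1" for \<sigma> u
  proof (rule suminf_le_of_finite_sums)
    show "summable (\<lambda>n. real n powr (-\<sigma>) * fejer R (u - ln (real n)))"
      using summable_fejer_mean[of "\<lambda>_. 1", OF _ \<sigma> R] ln_of_nat_nonneg by simp
    fix F :: "nat set" assume F: "finite F"
    have "(\<Sum>n\<in>F. real n powr (-\<sigma>) * fejer R (u - ln (real n)))
        \<le> (\<Sum>n\<in>F. real n powr (-\<sigma>) * (2 * A * (1 / (1 + (u - ln (real n))\<^sup>2))))"
      by (intro sum_mono mult_left_mono le) auto
    also have "\<dots> = 2 * A * (\<Sum>n\<in>F. real n powr (-\<sigma>) * (1 / (1 + (u - ln (real n))\<^sup>2)))"
      by (simp add: sum_distrib_left mult_ac)
    also have "\<dots> \<le> 2 * A * (2 * exp 1 * ?T)"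
      using R F \<sigma> by (intro mult_left_mono sum_over_unit_windows_le sum_powr_window_le) (auto simp: A_def)
    finally show "(\<Sum>n\<in>F. real n powr (-\<sigma>) * fejer R (u - ln (real n))) \<le> 2 * A * (2 * exp 1 * ?T)" .
  qed
  then show ?thesis by blast
qed

lemma fejer_mean_mangoldt_eq:
  assumes \<sigma>: "\<sigma> > 1" and R: "R > 0"
  shows "(\<Sum>n. mangoldt n * real n powr (-\<sigma>) * fejer R (u - ln (real n)))
    = (\<Sum>n. real n powr (-\<sigma>) * fejer R (u - ln (real n)))
      + (\<Sum>n. (mangoldt n - 1) * real n powr (-\<sigma>) * fejer R (u - ln (real n)))"
proof -
  have 1: "summable (\<lambda>n. real n powr (-\<sigma>) * fejer R (u - ln (real n)))"
    using summable_fejer_mean[of "\<lambda>_. 1", OF _ \<sigma> R] ln_of_nat_nonneg by simp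
  have 2: "summable (\<lambda>n. (mangoldt n - 1) * real n powr (-\<sigma>) * fejer R (u - ln (real n)))"
    by (intro summable_fejer_mean abs_mangoldt_minus_one_le \<sigma> R)
  show ?thesis by (subst suminf_add[OF 1 2]) (simp add: algebra_simps)
qed

lemma summable_fejer_mean_mangoldt:
  assumes \<sigma>: "\<sigma> > 1" and R: "R > 0"
  shows "summable (\<lambda>n. mangoldt n * real n powr (-\<sigma>) * fejer R (u - ln (real n)))"
proof (rule summable_fejer_mean[OF _ \<sigma> R])
  show "\<bar>mangoldt n\<bar> \<le> ln (real n) + 1" for n
    using mangoldt_le_ln[of n] by simp
qed

text \<open>A Chebyshev-type bound: \<open>fejer 1\<close> is at least \<open>1 / 4\<close> on the
  window, so the sum is at most four times the Fejer mean at \<open>v\<close>, which splits into the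
  bounded means of \<open>1\<close> and of \<open>mangoldt n - 1\<close>.\<close>

lemma sum_mangoldt_window_le:
  "\<exists>C. \<forall>\<sigma> v F. 1 < \<sigma> \<and> \<sigma> \<le> 2 \<and> finite F \<and> (\<forall>n\<in>F. v \<le> ln (real n) \<and> ln (real n) \<le> v + 1)
     \<longrightarrow> (\<Sum>n\<in>F. mangoldt n * real n powr (-\<sigma>)) \<le> C"
proof -
  obtain C where C: "\<And>\<sigma> u. \<sigma> > 1 \<Longrightarrow> (\<Sum>n. real n powr (-\<sigma>) * fejer 1 (u - ln (real n))) \<le> C"
    using fejer_mean_one_le[of 1] by auto
  obtain M where M: "\<And>\<sigma> u. 1 < \<sigma> \<Longrightarrow> \<sigma> \<le> 2 \<Longrightarrow>
      \<bar>\<Sum>n. (mangoldt n - 1) * real n powr (-\<sigma>) * fejer 1 (u - ln (real n))\<bar> \<le> M"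
    using fejer_mean_mangoldt_minus_one(1)[of 1] by auto
  have "(\<Sum>n\<in>F. mangoldt n * real n powr (-\<sigma>)) \<le> 4 * (C + M)"
    if \<sigma>: "1 < \<sigma>" "\<sigma> \<le> 2" and F: "finite F" "\<forall>n\<in>F. v \<le> ln (real n) \<and> ln (real n) \<le> v + 1" for \<sigma> v F
  proof -
    have "(\<Sum>n\<in>F. mangoldt n * real n powr (-\<sigma>)) * (1 / 4)
        = (\<Sum>n\<in>F. mangoldt n * real n powr (-\<sigma>) * (1 / 4))"
      by (rule sum_distrib_right)
    also have "\<dots> \<le> (\<Sum>n\<in>F. mangoldt n * real n powr (-\<sigma>) * fejer 1 (v - ln (real n)))"
    proof (rule sum_mono)
      fix n assume "n \<in> F"
      then have "\<bar>v - ln (real n)\<bar> \<le> 1 / 1" using F by auto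
      from fejer_ge[OF _ this] show "mangoldt n * real n powr (-\<sigma>) * (1 / 4)
          \<le> mangoldt n * real n powr (-\<sigma>) * fejer 1 (v - ln (real n))"
        by (intro mult_left_mono) (auto simp: mangoldt_nonneg)
    qed
    also have "\<dots> \<le> (\<Sum>n. mangoldt n * real n powr (-\<sigma>) * fejer 1 (v - ln (real n)))"
      using \<sigma> F by (intro sum_le_suminf summable_fejer_mean_mangoldt) (auto simp: mangoldt_nonneg fejer_nonneg)
    also have "\<dots> \<le> C + M"
      unfolding fejer_mean_mangoldt_eq[OF \<sigma>(1) zero_less_one]
      using C[OF \<sigma>(1), of v] M[OF \<sigma>, of v] by linarith
    finally show ?thesis by simp
  qed
  then show ?thesis by (intro exI[of _ "4 * (C + M)"]) auto
qed

text \<open>With \<open>y = exp u\<close>, at least \<open>y / (2 * R)\<close> integers lie in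
  \<open>[y, y * exp (1 / R)]\<close>; for each the kernel is at least \<open>R / 4\<close> and the
  power at least \<open>1 / (2 * exp 1 * y)\<close>. The product does not depend on
  \<open>R\<close>, so \<open>R\<close> can be chosen large afterwards.\<close>

lemma fejer_mean_one_ge:
  assumes R: "R \<ge> 1" and u: "u \<ge> 0" "exp u \<ge> 2 * R" and \<sigma>: "\<sigma> > 1" "(\<sigma> - 1) * (u + 1) \<le> 1 / 2"
  shows "1 / (16 * exp 1) \<le> (\<Sum>n. real n powr (-\<sigma>) * fejer R (u - ln (real n)))"
proof -
  define y where "y = exp u"
  have y: "y \<ge> 2 * R" "y \<ge> 1" using u R by (auto simp: y_def)
  define F where "F = {nat \<lceil>y\<rceil>..nat \<lfloor>y * exp (1 / R)\<rfloor>}"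
  have F: "y \<le> real n" "real n \<le> y * exp (1 / R)" "real n > 0" if "n \<in> F" for n
  proof -
    have "nat \<lceil>y\<rceil> \<le> n" "n \<le> nat \<lfloor>y * exp (1 / R)\<rfloor>" using that by (auto simp: F_def)
    moreover have "y * exp (1 / R) \<ge> 0" using y by simp
    ultimately show "y \<le> real n" "real n \<le> y * exp (1 / R)" by linarith+
    then show "real n > 0" using y by linarith
  qed
  have eR: "exp (1 / R) \<ge> 1 + 1 / R" "exp (1 / R) \<le> exp 1" using R by (auto simp: exp_ge_add_one_self)
  \<comment> \<open>\<open>y \<ge> 2 * R\<close> absorbs the loss of \<open>1\<close> from rounding
    the end points.\<close>
  have "y / (2 * R) \<ge> 1" using y R by simp
  moreover have "y * exp (1 / R) \<ge> y * (1 + 1 / R)" using y eR by (intro mult_left_mono) auto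
  then have "y * exp (1 / R) \<ge> y + 2 * (y / (2 * R))" by (simp add: algebra_simps)
  moreover have "real (card F) \<ge> y * exp (1 / R) - y - 1"
    unfolding F_def using y by (simp add: of_nat_diff_real) linarith
  ultimately have card: "real (card F) \<ge> y / (2 * R)" by linarith
  have tm: "1 / (2 * exp 1 * y) * (R / 4) \<le> real n powr (-\<sigma>) * fejer R (u - ln (real n))"
    if n: "n \<in> F" for n
  proof (rule mult_mono)
    have ln: "u \<le> ln (real n)" "ln (real n) \<le> u + 1 / R"
    proof -
      have "ln y \<le> ln (real n)" "ln (real n) \<le> ln (y * exp (1 / R))"
        using F[OF n] y by (auto simp: ln_le_cancel_iff)
      then show "u \<le> ln (real n)" "ln (real n) \<le> u + 1 / R"
        by (auto simp: y_def ln_mult)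
    qed
    then show "R / 4 \<le> fejer R (u - ln (real n))" using R by (intro fejer_ge) auto
    have "ln (real n) \<le> u + 1" using ln(2) R by (smt (verit) divide_le_eq_1)
    then have "(\<sigma> - 1) * ln (real n) \<le> (\<sigma> - 1) * (u + 1)" using \<sigma> by (intro mult_left_mono) auto
    then have "\<sigma> * ln (real n) \<le> u + 1 + 1 / 2"
      using \<sigma> \<open>ln (real n) \<le> u + 1\<close> by (simp add: algebra_simps)
    then have "exp (- (1 / 2)) * exp (- 1 - u) \<le> real n powr (-\<sigma>)"
      using F[OF n] by (simp add: powr_def flip: exp_add)
    moreover have "1 / 2 \<le> exp (- (1 / 2) :: real)"
      using exp_ge_add_one_self[of "- (1 / 2) :: real"] by simp
    then have "1 / 2 * exp (- 1 - u) \<le> exp (- (1 / 2)) * exp (- 1 - u)"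
      by (intro mult_right_mono) auto
    moreover have "1 / (2 * exp 1 * y) = 1 / 2 * exp (- 1 - u)"
      by (simp add: y_def exp_diff exp_minus field_simps)
    ultimately show "1 / (2 * exp 1 * y) \<le> real n powr (-\<sigma>)" by linarith
  qed (use R in auto)
  have "1 / (16 * exp 1) = y / (2 * R) * (1 / (2 * exp 1 * y) * (R / 4))"
    using y R by (simp add: field_simps)
  also have "\<dots> \<le> real (card F) * (1 / (2 * exp 1 * y) * (R / 4))"
    using card y R by (intro mult_right_mono) auto
  also have "\<dots> = (\<Sum>n\<in>F. 1 / (2 * exp 1 * y) * (R / 4))" by simp
  also have "\<dots> \<le> (\<Sum>n\<in>F. real n powr (-\<sigma>) * fejer R (u - ln (real n)))"
    by (intro sum_mono tm)
  also have "\<dots> \<le> (\<Sum>n. real n powr (-\<sigma>) * fejer R (u - ln (real n)))"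
  proof (rule sum_le_suminf)
    show "summable (\<lambda>n. real n powr (-\<sigma>) * fejer R (u - ln (real n)))"
      using summable_fejer_mean[of "\<lambda>_. 1", OF _ \<sigma>(1), of R] R ln_of_nat_nonneg by simp
  qed (use R in \<open>auto simp: F_def fejer_nonneg\<close>)
  finally show ?thesis .
qed

section \<open>Prime powers from localised Fejer means\<close>

lemma finite_ln_window: "finite {n. \<bar>u - ln (real n)\<bar> \<le> \<epsilon>}"
proof (rule finite_subset)
  show "{n. \<bar>u - ln (real n)\<bar> \<le> \<epsilon>} \<subseteq> {..nat \<lfloor>exp (u + \<epsilon>)\<rfloor>}"
  proof
    fix n assume "n \<in> {n. \<bar>u - ln (real n)\<bar> \<le> \<epsilon>}"
    then have "exp (ln (real n)) \<le> exp (u + \<epsilon>)" by auto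
    then have "real n \<le> exp (u + \<epsilon>)" by (cases "n = 0") auto
    then show "n \<in> {..nat \<lfloor>exp (u + \<epsilon>)\<rfloor>}" by (simp add: le_nat_floor)
  qed
qed simp

text \<open>For large \<open>u\<close> the Fejer mean of \<open>mangoldt\<close> is at least
  \<open>c0 - c0 / 4\<close>. Outside the window it contributes at most \<open>c0 / 4\<close>, so
  the window carries at least \<open>c0 / 2\<close>, and there the kernel is at most
  \<open>R\<close>.\<close>

lemma mangoldt_short_interval_ge:
  assumes \<epsilon>: "0 < \<epsilon>" "\<epsilon> \<le> 1"
  shows "\<exists>c>0. \<exists>U. \<forall>u\<ge>U. c \<le> (\<Sum>n | \<bar>u - ln (real n)\<bar> \<le> \<epsilon>. mangoldt n * real n powr (-1))"
proof -
  obtain C where C: "\<And>\<sigma> v F. 1 < \<sigma> \<Longrightarrow> \<sigma> \<le> 2 \<Longrightarrow> finite F \<Longrightarrow>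
      \<forall>n\<in>F. v \<le> ln (real n) \<and> ln (real n) \<le> v + 1 \<Longrightarrow> (\<Sum>n\<in>F. mangoldt n * real n powr (-\<sigma>)) \<le> C"
    using sum_mangoldt_window_le by meson
  have C0: "C \<ge> 0" using C[of 2 "{}"] by simp
  define T where "T = (\<Sum>k. 1 / (1 + (real k)\<^sup>2))"
  define c0 where "c0 = 1 / (16 * exp (1::real))"
  \<comment> \<open>\<open>R\<close> is large enough that kernel decay times the unit-window bound
    \<open>2 * C * T\<close> is at most \<open>c0 / 4\<close>.\<close>
  define R where "R = 1 + 4 * (8 * C * \<bar>T\<bar>) / (\<epsilon>\<^sup>2 * c0)"
  have c0: "c0 > 0" by (simp add: c0_def)
  have R: "R \<ge> 1" using C0 c0 by (simp add: R_def)
  have tail: "4 / (R * \<epsilon>\<^sup>2) * (2 * C * T) \<le> c0 / 4"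
  proof -
    have "4 * (8 * C * \<bar>T\<bar>) / (\<epsilon>\<^sup>2 * c0) \<le> R" by (simp add: R_def)
    then have "4 * (8 * C * \<bar>T\<bar>) \<le> R * (\<epsilon>\<^sup>2 * c0)"
      using \<epsilon> c0 by (simp add: pos_divide_le_eq)
    moreover have "8 * C * T \<le> 8 * C * \<bar>T\<bar>" using C0 by (intro mult_left_mono) auto
    ultimately have "8 * C * T \<le> (c0 / 4) * (R * \<epsilon>\<^sup>2)" by (simp add: mult_ac)
    moreover have "R * \<epsilon>\<^sup>2 > 0" using R \<epsilon> by simp
    ultimately have "8 * C * T / (R * \<epsilon>\<^sup>2) \<le> c0 / 4" by (simp add: pos_divide_le_eq)
    then show ?thesis by simp
  qed
  obtain U \<delta> where U: "\<delta> > 0" "\<And>u \<sigma>. u \<ge> U \<Longrightarrow> 1 < \<sigma> \<Longrightarrow> \<sigma> < 1 + \<delta> \<Longrightarrow>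
      \<bar>\<Sum>n. (mangoldt n - 1) * real n powr (-\<sigma>) * fejer R (u - ln (real n))\<bar> \<le> c0 / 4"
    using fejer_mean_mangoldt_minus_one(2)[of R "c0 / 4"] R c0 by auto
  have "c0 / (2 * R) \<le> (\<Sum>n | \<bar>u - ln (real n)\<bar> \<le> \<epsilon>. mangoldt n * real n powr (-1))"
    if u: "u \<ge> max U (max 0 (ln (2 * R)))" for u
  proof -
    have u': "u \<ge> U" "u \<ge> 0" "exp u \<ge> 2 * R"
    proof -
      show "u \<ge> U" "u \<ge> 0" using u by auto
      have "exp (ln (2 * R)) \<le> exp u" using u by simp
      then show "exp u \<ge> 2 * R" using R by simp
    qed
    \<comment> \<open>\<open>\<sigma>\<close> depends on \<open>u\<close>: it is within
      \<open>\<delta>\<close> of \<open>1\<close> for the error term, and within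
      \<open>1 / (2 * (u + 1))\<close> for the lower bound on the mean of \<open>1\<close>.\<close>
    define \<sigma> where "\<sigma> = 1 + min (\<delta> / 2) (1 / (2 * (u + 1)))"
    have \<sigma>: "1 < \<sigma>" "\<sigma> < 1 + \<delta>" "(\<sigma> - 1) * (u + 1) \<le> 1 / 2" "\<sigma> \<le> 2"
    proof -
      show "1 < \<sigma>" "\<sigma> < 1 + \<delta>" using U(1) u' by (auto simp: \<sigma>_def)
      have "(\<sigma> - 1) * (u + 1) \<le> 1 / (2 * (u + 1)) * (u + 1)"
        using u' by (intro mult_right_mono) (auto simp: \<sigma>_def)
      also have "\<dots> = 1 / 2" using u' by (simp add: field_simps)
      finally show "(\<sigma> - 1) * (u + 1) \<le> 1 / 2" .
      have "1 / (2 * (u + 1)) \<le> 1" using u' by simp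
      then show "\<sigma> \<le> 2" unfolding \<sigma>_def by linarith
    qed
    let ?W = "{n. \<bar>u - ln (real n)\<bar> \<le> \<epsilon>}"
    define a where "a n = mangoldt n * real n powr (-\<sigma>) * fejer R (u - ln (real n))" for n
    have a0: "a n \<ge> 0" for n using R by (simp add: a_def mangoldt_nonneg fejer_nonneg)
    have sum_a: "summable a" unfolding a_def using \<sigma> R by (intro summable_fejer_mean_mangoldt) auto
    have "c0 - c0 / 4 \<le> suminf a"
      unfolding a_def using fejer_mean_mangoldt_eq[OF \<sigma>(1), of R u] R
        fejer_mean_one_ge[OF R u'(2,3) \<sigma>(1,3)] U(2)[OF u'(1) \<sigma>(1,2)] c0_def by linarith
    also have "suminf a \<le> sum a ?W + c0 / 4"
    proof (rule suminf_le_of_finite_sums[OF sum_a])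
      fix F :: "nat set" assume F: "finite F"
      have "sum a F = sum a (F \<inter> ?W) + sum a (F - ?W)"
        using F by (metis sum.Int_Diff)
      also have "sum a (F \<inter> ?W) \<le> sum a ?W"
        using finite_ln_window a0 by (intro sum_mono2) auto
      also have "sum a (F - ?W) \<le> (\<Sum>n\<in>F-?W. (4 / (R * \<epsilon>\<^sup>2)) *
          (mangoldt n * real n powr (-\<sigma>) * (1 / (1 + (u - ln (real n))\<^sup>2))))"
      proof (rule sum_mono)
        fix n assume "n \<in> F - ?W"
        then have "fejer R (u - ln (real n)) \<le> 4 / (R * \<epsilon>\<^sup>2) * (1 / (1 + (u - ln (real n))\<^sup>2))"
          using R \<epsilon> by (intro fejer_decay) auto
        then have "a n \<le> mangoldt n * real n powr (-\<sigma>) *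
            (4 / (R * \<epsilon>\<^sup>2) * (1 / (1 + (u - ln (real n))\<^sup>2)))"
          unfolding a_def by (rule mult_left_mono) (simp add: mangoldt_nonneg)
        then show "a n \<le> (4 / (R * \<epsilon>\<^sup>2)) *
            (mangoldt n * real n powr (-\<sigma>) * (1 / (1 + (u - ln (real n))\<^sup>2)))"
          by (simp only: mult_ac)
      qed
      also have "\<dots> = 4 / (R * \<epsilon>\<^sup>2) *
          (\<Sum>n\<in>F-?W. mangoldt n * real n powr (-\<sigma>) * (1 / (1 + (u - ln (real n))\<^sup>2)))"
        by (rule sum_distrib_left[symmetric])
      also have "\<dots> \<le> 4 / (R * \<epsilon>\<^sup>2) * (2 * C * T)"
        unfolding T_def using R F C[OF \<sigma>(1,4)]
        by (intro mult_left_mono sum_over_unit_windows_le) (auto simp: mangoldt_nonneg)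
      finally show "sum a F \<le> sum a ?W + c0 / 4" using tail by linarith
    qed
    finally have "c0 / 2 \<le> sum a ?W" by linarith
    also have "\<dots> \<le> (\<Sum>n\<in>?W. mangoldt n * real n powr (-1) * R)"
    proof (rule sum_mono)
      fix n
      have "real n powr (-\<sigma>) \<le> real n powr (-1)"
      proof (cases "n = 0")
        case False
        then show ?thesis using \<sigma> by (intro powr_mono) linarith+
      qed simp
      then show "a n \<le> mangoldt n * real n powr (-1) * R"
        unfolding a_def using R fejer_le[of R] fejer_nonneg[of R]
        by (intro mult_mono mult_nonneg_nonneg) (auto simp: mangoldt_nonneg)
    qed
    also have "\<dots> = (\<Sum>n\<in>?W. mangoldt n * real n powr (-1)) * R"
      by (rule sum_distrib_right[symmetric])
    finally have "c0 / 2 \<le> (\<Sum>n\<in>?W. mangoldt n * real n powr (-1)) * R" .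
    then show ?thesis using R by (simp add: field_simps)
  qed
  moreover have "c0 / (2 * R) > 0" using c0 R by simp
  ultimately show ?thesis by blast
qed

text \<open>Each prime power in the window contributes at most
  \<open>(ln x + 2 * \<eta>) / x\<close>, which tends to \<open>0\<close>, so \<open>m\<close> of
  them or fewer cannot make up a sum of at least \<open>c\<close>.\<close>

lemma eventually_primepows_in_short_interval:
  assumes \<epsilon>: "0 < \<epsilon>" "\<epsilon> \<le> 1"
  shows "\<forall>\<^sub>F x in at_top. \<exists>Q. finite Q \<and> card Q = m \<and>
           (\<forall>q\<in>Q. primepow q \<and> x \<le> real q \<and> real q \<le> (1 + \<epsilon>) * x)"
proof -
  \<comment> \<open>The window of radius \<open>\<eta>\<close> about \<open>ln x + \<eta>\<close> is
    exactly \<open>[ln x, ln ((1 + \<epsilon>) * x)]\<close>.\<close>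
  define \<eta> where "\<eta> = ln (1 + \<epsilon>) / 2"
  have \<eta>: "0 < \<eta>" "\<eta> \<le> 1"
    using \<epsilon> ln_le_minus_one[of "1 + \<epsilon>"] by (auto simp: \<eta>_def)
  obtain c U where c: "c > 0"
    and U: "\<And>u. u \<ge> U \<Longrightarrow> c \<le> (\<Sum>n | \<bar>u - ln (real n)\<bar> \<le> \<eta>. mangoldt n * real n powr (-1))"
    using mangoldt_short_interval_ge[OF \<eta>] by blast
  have "filterlim (\<lambda>x. ln x + \<eta>) at_top at_top" by real_asymp
  then have ev1: "\<forall>\<^sub>F x in at_top. ln x + \<eta> \<ge> U" unfolding filterlim_at_top by blast
  have "((\<lambda>x. real m * ((ln x + 2 * \<eta>) / x)) \<longlongrightarrow> 0) at_top" by real_asymp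
  then have ev2: "\<forall>\<^sub>F x in at_top. real m * ((ln x + 2 * \<eta>) / x) < c"
    using c by (rule order_tendstoD(2))
  show ?thesis
    using ev1 ev2 eventually_ge_at_top[of 1]
  proof eventually_elim
    case (elim x)
    define W where "W = {n. \<bar>ln x + \<eta> - ln (real n)\<bar> \<le> \<eta>}"
    define P where "P = {n\<in>W. primepow n}"
    have finW: "finite W" unfolding W_def by (rule finite_ln_window)
    have bounds: "x \<le> real n" "real n \<le> (1 + \<epsilon>) * x" "ln (real n) \<le> ln x + 2 * \<eta>" if "n \<in> P" for n
    proof -
      have n0: "real n > 0" using that primepow_gt_0_nat[of n] by (simp add: P_def)
      have *: "ln x \<le> ln (real n)" "ln (real n) \<le> ln x + 2 * \<eta>" using that by (auto simp: P_def W_def)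
      then have "ln (real n) \<le> ln ((1 + \<epsilon>) * x)" using \<epsilon> elim by (simp add: ln_mult \<eta>_def)
      then show "x \<le> real n" "real n \<le> (1 + \<epsilon>) * x" "ln (real n) \<le> ln x + 2 * \<eta>"
        using * n0 elim \<epsilon> by (auto simp: ln_le_cancel_iff)
    qed
    have "c \<le> (\<Sum>n\<in>W. mangoldt n * real n powr (-1))"
      unfolding W_def by (rule U) (use elim in simp)
    also have "\<dots> = (\<Sum>n\<in>P. mangoldt n * real n powr (-1))"
      using finW by (intro sum.mono_neutral_right) (auto simp: P_def mangoldt_def)
    also have "\<dots> \<le> (\<Sum>n\<in>P. (ln x + 2 * \<eta>) * (1 / x))"
    proof (rule sum_mono)
      fix n assume n: "n \<in> P"
      have "inverse (real n) \<le> inverse x"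
        using bounds(1)[OF n] elim by (intro le_imp_inverse_le) auto
      then have "real n powr (-1) \<le> 1 / x"
        using bounds(1)[OF n] elim by (simp add: powr_minus inverse_eq_divide)
      then show "mangoldt n * real n powr (-1) \<le> (ln x + 2 * \<eta>) * (1 / x)"
        using bounds(3)[OF n] mangoldt_le_ln[of n] elim \<eta> by (intro mult_mono) auto
    qed
    also have "\<dots> = real (card P) * ((ln x + 2 * \<eta>) / x)" by simp
    finally have "real m * ((ln x + 2 * \<eta>) / x) < real (card P) * ((ln x + 2 * \<eta>) / x)"
      using elim by linarith
    moreover have "(ln x + 2 * \<eta>) / x > 0" using elim \<eta> by (intro divide_pos_pos add_nonneg_pos) auto
    ultimately have "real m < real (card P)" by (meson less_imp_le mult_right_less_imp_less)
    then have "m \<le> card P" by simp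
    then obtain Q where "Q \<subseteq> P" "card Q = m" "finite Q"
      using obtain_subset_with_card_n by metis
    then show ?case using bounds by (intro exI[of _ Q]) (auto simp: P_def)
  qed
qed

section \<open>Choice of parameters\<close>

text \<open>Two different powers of the same prime differ by a factor of at least
  \<open>2\<close>.\<close>

lemma coprime_primepow_of_less_double:
  fixes q q' :: nat
  assumes "primepow q" "primepow q'" "q \<noteq> q'" and close: "q < 2 * q'" "q' < 2 * q"
  shows "coprime q q'"
proof -
  obtain p k p' k' where q: "prime p" "q = p ^ k" and q': "prime p'" "q' = p' ^ k'"
    using assms by (auto simp: primepow_def)
  have no: "\<not> (i < j \<and> p ^ j < 2 * p ^ i)" for i j
  proof
    assume ij: "i < j \<and> p ^ j < 2 * p ^ i"
    have "2 * p ^ i \<le> p * p ^ i" using prime_ge_2_nat[OF q(1)] by (rule mult_le_mono1)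
    also have "\<dots> = p ^ Suc i" by simp
    also have "\<dots> \<le> p ^ j" using ij prime_ge_1_nat[OF q(1)] by (intro power_increasing) auto
    finally show False using ij by simp
  qed
  have "p \<noteq> p'"
  proof
    assume "p = p'"
    then have "k \<noteq> k'" using assms q q' by auto
    then show False
      using no[of k k'] no[of k' k] close q q' \<open>p = p'\<close> by (auto simp: neq_iff)
  qed
  then have "coprime p p'" using q q' primes_coprime by blast
  then show ?thesis using q q' by simp
qed

text \<open>A single term of the exponential series gives
  \<open>k ^ k \<le> exp k * fact k\<close>.\<close>

lemma binomial_le_exp_power:
  assumes k: "k \<ge> 1"
  shows "real (N choose k) \<le> (exp 1 * real N / real k) ^ k"
proof -
  have "inverse (fact k) * real k ^ k \<le> exp (real k)"
  proof -
    have "(\<Sum>n\<in>{k}. inverse (fact n) * real k ^ n) \<le> (\<Sum>n. inverse (fact n) * real k ^ n)"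
      using summable_exp[of "real k"] by (intro sum_le_suminf) auto
    then show ?thesis by (simp add: exp_def)
  qed
  then have *: "real k ^ k \<le> exp 1 ^ k * fact k"
    by (simp add: exp_of_nat_mult[symmetric] field_simps)
  have "real (N choose k) * fact k \<le> real N ^ k"
    using binomial_fact_pow[of N k] by (metis of_nat_fact of_nat_le_iff of_nat_mult of_nat_power)
  then have "real (N choose k) * fact k * real k ^ k \<le> real N ^ k * (exp 1 ^ k * fact k)"
    using * by (intro mult_mono) auto
  then have "real (N choose k) * real k ^ k \<le> real N ^ k * exp 1 ^ k"
    by (simp add: mult_ac)
  then show ?thesis using k by (simp add: power_divide power_mult_distrib field_simps)
qed

text \<open>Turns a bound that holds eventually for each fixed \<open>\<delta>\<close> into one with
  a single null sequence, without an explicit rate of convergence.\<close>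

lemma exists_vanishing_error:
  fixes P :: "real \<Rightarrow> nat \<Rightarrow> bool"
  assumes ev: "\<And>\<delta>. \<delta> > 0 \<Longrightarrow> \<forall>\<^sub>F n in sequentially. P \<delta> n"
    and mono: "\<forall>\<^sub>F n in sequentially. \<forall>\<delta> \<delta>'. P \<delta> n \<longrightarrow> \<delta> \<le> \<delta>' \<longrightarrow> P \<delta>' n"
  shows "\<exists>\<epsilon>. \<epsilon> \<longlonglongrightarrow> 0 \<and> (\<forall>\<^sub>F n in sequentially. P (\<epsilon> n) n)"
proof -
  define A where "A n = {\<delta>. \<delta> > 0 \<and> P \<delta> n}" for n
  \<comment> \<open>The infimum need not be attained; the added null sequence puts
    \<open>\<epsilon> n\<close> strictly above some admissible \<open>\<delta>\<close>.\<close>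
  define \<epsilon> where "\<epsilon> n = Inf (A n) + 1 / real (Suc n)" for n
  have bdd: "bdd_below (A n)" for n by (rule bdd_belowI[of _ 0]) (auto simp: A_def)
  have "\<epsilon> \<longlonglongrightarrow> 0"
  proof (rule tendstoI)
    fix e :: real assume e: "e > 0"
    have "(\<lambda>n. 1 / real (Suc n)) \<longlonglongrightarrow> 0" by (rule LIMSEQ_Suc[OF lim_1_over_n])
    then have "\<forall>\<^sub>F n in sequentially. 1 / real (Suc n) < e / 2"
      using e by (intro order_tendstoD(2)) auto
    moreover have "\<forall>\<^sub>F n in sequentially. P (e / 2) n" using e by (intro ev) simp
    ultimately show "\<forall>\<^sub>F n in sequentially. dist (\<epsilon> n) 0 < e"
    proof eventually_elim
      case (elim n)
      then have mem: "e / 2 \<in> A n" using e by (simp add: A_def)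
      then have "Inf (A n) \<le> e / 2" using bdd by (rule cInf_lower)
      moreover have "0 \<le> Inf (A n)" using mem by (intro cInf_greatest) (blast, simp add: A_def)
      moreover have "0 < 1 / real (Suc n)" by simp
      ultimately show ?case using elim unfolding \<epsilon>_def dist_real_def by linarith
    qed
  qed
  moreover have "\<forall>\<^sub>F n in sequentially. P (\<epsilon> n) n"
    using ev[OF zero_less_one] mono
  proof eventually_elim
    case (elim n)
    then have "1 \<in> A n" by (simp add: A_def)
    then have "A n \<noteq> {}" by blast
    moreover have "Inf (A n) < \<epsilon> n" by (simp add: \<epsilon>_def)
    ultimately obtain \<delta> where "\<delta> \<in> A n" "\<delta> < \<epsilon> n" using cInf_lessD by metis
    then have "P \<delta> n" "\<delta> \<le> \<epsilon> n" by (simp_all add: A_def)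
    then show ?case using elim(2) by blast
  qed
  ultimately show ?thesis by blast
qed

text \<open>\<open>x\<close> is the least number with \<open>n \<le> x ^ (x\<^sup>2)\<close>;
  minimality gives the second inequality, and \<open>x\<close> exceeds any given bound once
  \<open>n\<close> is large.\<close>

lemma eventually_least_scale:
  assumes "\<forall>\<^sub>F x in sequentially. Q x"
  shows "\<forall>\<^sub>F n in sequentially. \<exists>x. Q x \<and> n \<le> x ^ (x\<^sup>2) \<and> (x - 1) ^ ((x - 1)\<^sup>2) < n"
proof -
  obtain x0 where x0: "\<And>x. x \<ge> x0 \<Longrightarrow> Q x" using assms by (auto simp: eventually_sequentially)
  define f where "f x = x ^ (x\<^sup>2)" for x :: nat
  have f_ge: "x \<le> f x" for x
  proof (cases "x = 0")
    case False
    then show ?thesis using self_le_power[of x "x\<^sup>2"] by (simp add: f_def)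
  qed simp
  have f_mono: "f x \<le> f y" if "x \<le> y" "1 \<le> y" for x y
  proof -
    have "f x \<le> y ^ (x\<^sup>2)" unfolding f_def using that by (intro power_mono) auto
    also have "\<dots> \<le> f y" unfolding f_def using that by (intro power_increasing power_mono) auto
    finally show ?thesis .
  qed
  show ?thesis
    using eventually_gt_at_top[of "f (Suc x0)"]
  proof eventually_elim
    case (elim n)
    define x where "x = (LEAST x. n \<le> f x)"
    have x: "n \<le> f x" unfolding x_def by (rule LeastI[of _ n]) (rule f_ge)
    have "x > Suc x0"
    proof (rule ccontr)
      assume "\<not> x > Suc x0"
      then have "f x \<le> f (Suc x0)" by (intro f_mono) auto
      then show False using x elim by simp
    qed
    moreover have "\<not> n \<le> f (x - 1)"
      using calculation unfolding x_def by (intro not_less_Least) simp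
    ultimately show ?case using x x0[of x] by (intro exI[of _ x]) (auto simp: f_def)
  qed
qed

text \<open>As \<open>ln (12 * x\<^sup>2)\<close> is asymptotic to \<open>2 * ln x\<close>, the
  quotient of the left side by \<open>2 * (x - 1) * ln (x - 1)\<close> tends to
  \<open>1 + \<delta> / 4\<close>.\<close>

lemma eventually_scale_bound:
  fixes t :: nat and \<delta> :: real
  assumes \<delta>: "0 < \<delta>"
  shows "\<forall>\<^sub>F x in at_top. ln (real t) + (1 + \<delta> / 4) * x * ln (12 * x\<^sup>2)
           \<le> (1 + \<delta>) * (2 * (x - 1) * ln (x - 1))"
proof -
  have "((\<lambda>x. (ln (real t) + (1 + \<delta> / 4) * x * ln (12 * x\<^sup>2)) / (2 * (x - 1) * ln (x - 1))) \<longlongrightarrow> 1 + \<delta> / 4) at_top"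
    by real_asymp
  then have "\<forall>\<^sub>F x in at_top. (ln (real t) + (1 + \<delta> / 4) * x * ln (12 * x\<^sup>2)) / (2 * (x - 1) * ln (x - 1)) < 1 + \<delta>"
    using \<delta> by (intro order_tendstoD(2)) auto
  then show ?thesis
    using eventually_gt_at_top[of 2]
  proof eventually_elim
    case (elim x)
    then have "2 * (x - 1) * ln (x - 1) > 0" by simp
    then show ?case using elim by (simp add: pos_divide_less_eq)
  qed
qed

text \<open>With \<open>y = x - 1 \<ge> 3 > e\<close>,
  \<open>ln n \<ge> y\<^sup>2 * ln y \<ge> y\<^sup>2\<close> and hence
  \<open>ln (ln n) \<ge> 2 * ln y\<close>. Multiplying these gives
  \<open>(2 * y * ln y)\<^sup>2\<close>; this is the source of the constant \<open>2\<close> under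
  the root.\<close>

lemma sqrt_log_bound_ge:
  assumes x: "x \<ge> 4" and n: "(x - 1) ^ ((x - 1)\<^sup>2) < n"
  shows "2 * (real x - 1) * ln (real x - 1) \<le> sqrt (2 * ln (real n) * ln (ln (real n)))"
proof -
  define y where "y = real x - 1"
  have y: "y \<ge> 3" "real (x - 1) = y" using x by (auto simp: y_def of_nat_diff)
  have e: "exp 1 \<le> y" using y exp_le by linarith
  have lny: "ln y \<ge> 1" using e y by (simp add: ln_ge_iff)
  have "real ((x - 1) ^ ((x - 1)\<^sup>2)) \<le> real n" using n by linarith
  then have "y ^ ((x - 1)\<^sup>2) \<le> real n" by (simp only: of_nat_power y(2))
  then have "ln (y ^ ((x - 1)\<^sup>2)) \<le> ln (real n)"
    using y by (intro ln_mono) auto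
  moreover have "ln (y ^ ((x - 1)\<^sup>2)) = y\<^sup>2 * ln y" using y by (simp add: ln_realpow)
  ultimately have ln1: "y\<^sup>2 * ln y \<le> ln (real n)" by simp
  have "y\<^sup>2 * 1 \<le> y\<^sup>2 * ln y" using lny by (intro mult_left_mono) auto
  then have "y\<^sup>2 \<le> ln (real n)" using ln1 by linarith
  then have "ln (y\<^sup>2) \<le> ln (ln (real n))" using y by (intro ln_mono) auto
  then have ln2: "2 * ln y \<le> ln (ln (real n))" using y by (simp add: ln_realpow)
  have "(2 * y * ln y)\<^sup>2 = 2 * (y\<^sup>2 * ln y) * (2 * ln y)" by (simp add: power2_eq_square)
  also have "\<dots> \<le> 2 * ln (real n) * ln (ln (real n))"
    using ln1 ln2 lny by (intro mult_mono mult_nonneg_nonneg) (auto intro: order_trans[OF _ ln1])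
  finally show ?thesis unfolding y_def[symmetric] by (rule real_le_rsqrt)
qed

text \<open>With \<open>N = x ^ 3 + q \<le> 2 * x ^ 3\<close>, \<open>k = q - 1 \<ge> x / 2\<close>
  and \<open>e \<le> 3\<close>, the base \<open>e * N / k\<close> is at most
  \<open>12 * x\<^sup>2\<close>, and the exponent \<open>k\<close> is at most
  \<open>(1 + \<eta>) * x\<close>.\<close>

lemma scale_dimension_bound:
  fixes t x q :: nat
  assumes t: "t \<ge> 1" and x: "x \<ge> 4" and \<eta>: "0 \<le> \<eta>" "\<eta> \<le> 1" and q: "real x \<le> real q" "real q \<le> (1 + \<eta>) * real x"
  shows "real (t * ((x ^ 3 + q) choose (q - 1))) \<le> exp (ln (real t) + (1 + \<eta>) * real x * ln (12 * (real x)\<^sup>2))"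
proof -
  define k where "k = q - 1"
  have k: "real k \<ge> real x / 2" "k \<ge> 1" "real k \<le> (1 + \<eta>) * real x"
    using q x by (auto simp: k_def of_nat_diff)
  have "(1 + \<eta>) * real x \<le> 2 * real x" using \<eta> by (intro mult_right_mono) auto
  moreover have "2 * real x \<le> real x ^ 3"
  proof -
    have "4 * 4 \<le> real x * real x" using x by (intro mult_mono) auto
    then have "2 \<le> (real x)\<^sup>2" by (simp add: power2_eq_square)
    then have "2 * real x \<le> (real x)\<^sup>2 * real x" by (intro mult_right_mono) auto
    then show ?thesis by (simp add: power3_eq_cube power2_eq_square)
  qed
  ultimately have "real q \<le> real x ^ 3" using q(2) by linarith
  then have N: "real (x ^ 3 + q) \<le> 2 * real x ^ 3" unfolding of_nat_add of_nat_power by linarith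
  have "exp 1 * real (x ^ 3 + q) / real k \<le> 3 * (2 * real x ^ 3) / (real x / 2)"
    using N k x exp_le by (intro frac_le mult_mono) auto
  also have "\<dots> = 12 * (real x)\<^sup>2"
    using x by (simp add: power3_eq_cube power2_eq_square)
  finally have base: "exp 1 * real (x ^ 3 + q) / real k \<le> 12 * (real x)\<^sup>2" .
  have ge1: "12 * (real x)\<^sup>2 \<ge> 1"
  proof -
    have "(real x)\<^sup>2 \<ge> 1" using x by (intro one_le_power) auto
    then show ?thesis by simp
  qed
  have "real ((x ^ 3 + q) choose k) \<le> (exp 1 * real (x ^ 3 + q) / real k) ^ k"
    by (rule binomial_le_exp_power[OF k(2)])
  also have "\<dots> \<le> (12 * (real x)\<^sup>2) ^ k" using base by (intro power_mono) auto
  also have "\<dots> = exp (real k * ln (12 * (real x)\<^sup>2))"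
  proof -
    have "12 * (real x)\<^sup>2 = exp (ln (12 * (real x)\<^sup>2))"
      using ge1 by (intro exp_ln[symmetric]) linarith
    then show ?thesis by (metis exp_of_nat_mult)
  qed
  also have "\<dots> \<le> exp ((1 + \<eta>) * real x * ln (12 * (real x)\<^sup>2))"
    using k ge1 by (subst exp_le_cancel_iff, intro mult_right_mono) auto
  finally have "real t * real ((x ^ 3 + q) choose k) \<le> exp (ln (real t)) * exp ((1 + \<eta>) * real x * ln (12 * (real x)\<^sup>2))"
    using t by (intro mult_mono) auto
  then show ?thesis by (simp add: k_def exp_add)
qed

text \<open>\<open>x ^ 3 choose x\<^sup>2\<close> is at least
  \<open>(x ^ 3 / x\<^sup>2) ^ (x\<^sup>2) = x ^ (x\<^sup>2)\<close>, so there are enough sets for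
  \<open>n\<close> vertices.\<close>

lemma exists_uniform_set_system:
  assumes "n \<le> x ^ (x\<^sup>2)" "x \<ge> 1"
  obtains A :: "nat \<Rightarrow> nat set" where "inj_on A {..<n}"
    "\<And>v. v \<in> {..<n} \<Longrightarrow> A v \<subseteq> {..<x ^ 3} \<and> card (A v) = x\<^sup>2"
proof -
  let ?B = "{B. B \<subseteq> {..<x ^ 3} \<and> card B = x\<^sup>2}"
  have le: "x\<^sup>2 \<le> x ^ 3" using assms by (intro power_increasing) auto
  have "(real (x ^ 3) / real (x\<^sup>2)) ^ (x\<^sup>2) \<le> real (x ^ 3 choose x\<^sup>2)"
    by (rule binomial_ge_n_over_k_pow_k[OF le])
  moreover have "real (x ^ 3) / real (x\<^sup>2) = real x"
    using assms by (simp add: power3_eq_cube power2_eq_square)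
  ultimately have "real (x ^ (x\<^sup>2)) \<le> real (x ^ 3 choose x\<^sup>2)" by simp
  then have "x ^ (x\<^sup>2) \<le> x ^ 3 choose x\<^sup>2" by (simp only: of_nat_le_iff)
  then have "card {..<n} \<le> card ?B" using assms by (simp add: n_subsets)
  then obtain A where "A ` {..<n} \<subseteq> ?B" "inj_on A {..<n}"
    using card_le_inj[of "{..<n}" ?B] by auto
  then show ?thesis by (intro that[of A]) auto
qed

text \<open>One sequence \<open>\<epsilon>\<close> serves all \<open>X\<close> and is fixed before
  the graphs. The hypothesis \<open>{} \<notin> \<F>\<close> keeps the exponent meaningful: as
  \<open>1 / 0 = 0\<close>, the empty set would demand
  \<open>1 \<ge> n powr (1 / t)\<close>.\<close>

theorem theorem1p1:
  fixes t :: nat and \<F> :: "nat set set"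
  assumes "t \<ge> 2"
    and "\<F> \<subseteq> Pow {1..t}"
    and "{} \<notin> \<F>"
  shows "\<exists>\<epsilon> :: nat \<Rightarrow> real. \<epsilon> \<longlonglongrightarrow> 0 \<and>
    (\<forall>\<^sub>F n in sequentially. \<exists>G :: nat \<Rightarrow> nat pair_pre_digraph.
       (\<forall>i\<in>{1..t}. pair_graph (G i) \<and> card (pverts (G i)) = n) \<and>
       (\<forall>X\<subseteq>{1..t}.
          (\<forall>F\<in>\<F>. F \<subseteq> X \<longrightarrow>
             shannon_capacity (disjoint_graph_union X G) \<ge> real n powr (1 / real (card F)) \<and>
             real n powr (1 / real (card F)) \<ge> real n powr (1 / real t)) \<and>
          ((\<forall>F\<in>\<F>. \<not> F \<subseteq> X) \<longrightarrow>
             shannon_capacity (disjoint_graph_union X G)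
               \<le> exp ((1 + \<epsilon> n) * sqrt (2 * ln (real n) * ln (ln (real n)))))))"
proof (rule exists_vanishing_error)
  let ?b = "\<lambda>\<delta> n. exp ((1 + \<delta>) * sqrt (2 * ln (real n) * ln (ln (real n))))"
  let ?P = "\<lambda>\<delta> n. \<exists>G :: nat \<Rightarrow> nat pair_pre_digraph.
       (\<forall>i\<in>{1..t}. pair_graph (G i) \<and> card (pverts (G i)) = n) \<and>
       (\<forall>X\<subseteq>{1..t}.
          (\<forall>F\<in>\<F>. F \<subseteq> X \<longrightarrow>
             shannon_capacity (disjoint_graph_union X G) \<ge> real n powr (1 / real (card F)) \<and>
             real n powr (1 / real (card F)) \<ge> real n powr (1 / real t)) \<and>
          ((\<forall>F\<in>\<F>. \<not> F \<subseteq> X) \<longrightarrow> shannon_capacity (disjoint_graph_union X G) \<le> ?b \<delta> n))"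
  \<comment> \<open>For \<open>n \<ge> 3 > e\<close> the iterated logarithm, and with it the root,
    is nonnegative, so the bound increases with \<open>\<delta>\<close>.\<close>
  have mono: "?b \<delta> n \<le> ?b \<delta>' n" if "n \<ge> 3" "\<delta> \<le> \<delta>'" for n \<delta> \<delta>'
  proof -
    have "1 \<le> ln (real n)" using exp_le that by (subst ln_ge_iff) auto
    then have "0 \<le> sqrt (2 * ln (real n) * ln (ln (real n)))"
      by (simp add: ln_ge_zero)
    then show ?thesis using that by (simp add: mult_right_mono)
  qed
  show "\<forall>\<^sub>F n in sequentially. \<forall>\<delta> \<delta>'. ?P \<delta> n \<longrightarrow> \<delta> \<le> \<delta>' \<longrightarrow> ?P \<delta>' n"
    using eventually_ge_at_top[of 3]
  proof eventually_elim
    case (elim n)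
    show ?case
    proof (intro allI impI)
      fix \<delta> \<delta>' :: real assume P: "?P \<delta> n" and le: "\<delta> \<le> \<delta>'"
      from P obtain G :: "nat \<Rightarrow> nat pair_pre_digraph" where
        "\<forall>i\<in>{1..t}. pair_graph (G i) \<and> card (pverts (G i)) = n"
        "\<forall>X\<subseteq>{1..t}.
          (\<forall>F\<in>\<F>. F \<subseteq> X \<longrightarrow>
             shannon_capacity (disjoint_graph_union X G) \<ge> real n powr (1 / real (card F)) \<and>
             real n powr (1 / real (card F)) \<ge> real n powr (1 / real t)) \<and>
          ((\<forall>F\<in>\<F>. \<not> F \<subseteq> X) \<longrightarrow> shannon_capacity (disjoint_graph_union X G) \<le> ?b \<delta> n)"
        by blast
      then show "?P \<delta>' n"
        using order_trans[OF _ mono[OF elim le]] by (intro exI[of _ G]) blast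
    qed
  qed
  fix \<delta>0 :: real assume "\<delta>0 > 0"
  \<comment> \<open>Capping at \<open>1\<close> gives \<open>\<eta> \<le> 1 / 4\<close>, so the
    prime powers stay below \<open>2 * x\<close>, as coprimality requires;
    \<open>\<eta> = \<delta> / 4\<close> matches the slack in the scale bound.\<close>
  define \<delta> where "\<delta> = min \<delta>0 1"
  define \<eta> where "\<eta> = \<delta> / 4"
  have \<delta>: "0 < \<delta>" "\<delta> \<le> \<delta>0" and \<eta>: "0 < \<eta>" "\<eta> \<le> 1 / 4" using \<open>\<delta>0 > 0\<close> by (auto simp: \<delta>_def \<eta>_def)
  \<comment> \<open>One prime power for each subset of \<open>{1..t}\<close>.\<close>
  let ?m = "card (Pow {1..t})"
  let ?Q = "\<lambda>x. 4 \<le> x \<and> (\<exists>Q. finite Q \<and> card Q = ?m \<and>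
      (\<forall>q\<in>Q. primepow q \<and> x \<le> real q \<and> real q \<le> (1 + \<eta>) * x)) \<and>
      ln (real t) + (1 + \<eta>) * x * ln (12 * x\<^sup>2) \<le> (1 + \<delta>) * (2 * (x - 1) * ln (x - 1))"
  have "\<forall>\<^sub>F x in at_top. ?Q x"
    using eventually_primepows_in_short_interval[of \<eta> ?m] \<eta> eventually_scale_bound[OF \<delta>(1), of t]
    by (intro eventually_conj eventually_ge_at_top) (auto simp: \<eta>_def)
  then have "\<forall>\<^sub>F x in sequentially. ?Q (real x)"
    using filterlim_real_sequentially by (rule eventually_compose_filterlim)
  from eventually_conj[OF eventually_least_scale[OF this] eventually_ge_at_top[of 3]]
  show "\<forall>\<^sub>F n in sequentially. ?P \<delta>0 n"
  proof eventually_elim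
    case (elim n)
    then obtain x where x: "?Q (real x)" "n \<le> x ^ (x\<^sup>2)" "(x - 1) ^ ((x - 1)\<^sup>2) < n" and n: "n \<ge> 3"
      by blast
    then have x4: "x \<ge> 4" by simp
    from x(1) obtain Q where Q: "finite Q" "card Q = ?m"
      "\<And>q. q \<in> Q \<Longrightarrow> primepow q \<and> real x \<le> real q \<and> real q \<le> (1 + \<eta>) * real x"
      by blast
    obtain q where q: "q ` Pow {1..t} \<subseteq> Q" "inj_on q (Pow {1..t})"
      using card_le_inj[of "Pow {1..t}" Q] Q by auto
    have qQ: "q Y \<in> Q" if "Y \<subseteq> {1..t}" for Y using that q by blast
    obtain A :: "nat \<Rightarrow> nat set" where A: "inj_on A {..<n}"
      "\<And>v. v \<in> {..<n} \<Longrightarrow> A v \<subseteq> {..<x ^ 3} \<and> card (A v) = x\<^sup>2"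
      using exists_uniform_set_system[OF x(2)] x4 by (metis le_trans one_le_numeral)
    have pp: "primepow (q Y)" if "Y \<subseteq> {1..t}" for Y using Q(3) qQ[OF that] by blast
    have cop: "coprime (q Y) (q Z) \<and> x\<^sup>2 < q Y * q Z" if YZ: "Y \<subseteq> {1..t}" "Z \<subseteq> {1..t}" "Y \<noteq> Z" for Y Z
    proof
      have ne: "q Y \<noteq> q Z" using q(2) YZ by (auto simp: inj_on_def)
      have b: "x \<le> q Y" "x \<le> q Z" "real (q Y) \<le> (1 + \<eta>) * real x" "real (q Z) \<le> (1 + \<eta>) * real x"
        using Q(3)[OF qQ[OF YZ(1)]] Q(3)[OF qQ[OF YZ(2)]] by auto
      have "(1 + \<eta>) * real x < 2 * real x" using \<eta> x4 by (intro mult_strict_right_mono) auto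
      then have "q Y < 2 * q Z" "q Z < 2 * q Y" using b by linarith+
      then show "coprime (q Y) (q Z)"
        using coprime_primepow_of_less_double pp YZ ne by blast
      \<comment> \<open>Two distinct numbers that are at least \<open>x\<close> cannot both equal
        \<open>x\<close>; this makes the product strictly larger than the set size
        \<open>x\<^sup>2\<close>.\<close>
      consider "x < q Y" | "x < q Z" using b ne by linarith
      then show "x\<^sup>2 < q Y * q Z"
      proof cases
        case 1
        then have "x * x < q Y * x" using x4 by simp
        also have "\<dots> \<le> q Y * q Z" by (rule mult_le_mono2[OF b(2)])
        finally show ?thesis by (simp add: power2_eq_square)
      next
        case 2
        then have "x * x < x * q Z" using x4 by simp
        also have "\<dots> \<le> q Y * q Z" by (rule mult_le_mono1[OF b(1)])
        finally show ?thesis by (simp add: power2_eq_square)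
      qed
    qed
    obtain G :: "nat \<Rightarrow> nat pair_pre_digraph" where G:
      "\<And>i. pair_graph (G i)" "\<And>i. pverts (G i) = {..<n}"
      "\<And>X F. X \<subseteq> {1..t} \<Longrightarrow> F \<in> \<F> \<Longrightarrow> F \<subseteq> X \<Longrightarrow>
         real (card {..<n}) powr (1 / real (card F)) \<le> shannon_capacity (disjoint_graph_union X G)"
      "\<And>X. X \<subseteq> {1..t} \<Longrightarrow> \<forall>F\<in>\<F>. \<not> F \<subseteq> X \<Longrightarrow>
         shannon_capacity (disjoint_graph_union X G)
           \<le> real (card X * ((card {..<x ^ 3} + q X) choose (q X - 1)))"
      by (rule exists_privileged_graphs[OF finite_atLeastAtMost finite_lessThan finite_lessThan
            A assms(3) pp cop]) (assumption | rule that)+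
    have up: "shannon_capacity (disjoint_graph_union X G) \<le> ?b \<delta>0 n"
      if X: "X \<subseteq> {1..t}" "\<forall>F\<in>\<F>. \<not> F \<subseteq> X" for X
    proof -
      have "card X \<le> t" using card_mono[OF _ X(1)] by simp
      then have "card X * ((x ^ 3 + q X) choose (q X - 1)) \<le> t * ((x ^ 3 + q X) choose (q X - 1))"
        by (rule mult_le_mono1)
      then have "shannon_capacity (disjoint_graph_union X G) \<le> real (t * ((x ^ 3 + q X) choose (q X - 1)))"
        using G(4)[OF X] unfolding card_lessThan by linarith
      also have "\<dots> \<le> exp (ln (real t) + (1 + \<eta>) * real x * ln (12 * (real x)\<^sup>2))"
        using Q(3)[OF qQ[OF X(1)]] assms(1) x4 \<eta> by (intro scale_dimension_bound) auto
      also have "\<dots> \<le> exp ((1 + \<delta>) * (2 * (real x - 1) * ln (real x - 1)))"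
        using x(1) by simp
      also have "\<dots> \<le> ?b \<delta> n"
        using sqrt_log_bound_ge[OF x4 x(3)] \<delta> by (subst exp_le_cancel_iff, intro mult_left_mono) auto
      also have "\<dots> \<le> ?b \<delta>0 n" using mono[OF n \<delta>(2)] .
      finally show ?thesis .
    qed
    have root: "real n powr (1 / real t) \<le> real n powr (1 / real (card F))" if "F \<in> \<F>" for F
    proof -
      have "F \<subseteq> {1..t}" "F \<noteq> {}" using assms that by auto
      then have "card F \<le> t" "card F > 0"
        using card_mono[of "{1..t}" F] finite_subset[of F "{1..t}"] by (auto simp: card_gt_0_iff)
      then show ?thesis using n by (intro powr_mono divide_left_mono) auto
    qed
    have "pair_graph (G i) \<and> card (pverts (G i)) = n" for i using G(1,2) by simp
    moreover have "real n powr (1 / real (card F)) \<le> shannon_capacity (disjoint_graph_union X G)"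
      if "X \<subseteq> {1..t}" "F \<in> \<F>" "F \<subseteq> X" for X F
      using G(3)[OF that] by simp
    ultimately show ?case using up root by (intro exI[of _ G]) blast
  qed
qed

end
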